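(* Let $c,\mu,\zeta>0$ be constants, $r=c^{-1}$, and let $\theta:\mathbb{R}\to\mathbb{R}$ be a $C^1$ globally Lipschitz function with $\theta(0)=0$. Consider the chemical reactor model $$\frac{d\bar x}{dt}(t)=\theta(\bar x(t))-(\mu+1)\bar x(t)+\mu\int_0^1v(t,z)dz+u(t),\qquad \frac{\partial v}{\partial t}(t,z)+c\frac{\partial v}{\partial z}(t,z)=-\zeta v(t,z)+\zeta\bar x(t),\qquad v(t,0)=0, \qquad ( * )$$ for $t\ge0$, $z\in[0,1]$, with initial condition $\bar x(0)=\bar x_0$, $v[0]=v_0$. Then there exist constants $k_1,k_2,\delta,P,M,\omega>0$ such that for every sampling sequence $\{\tau_i\}_{i=0}^\infty$ with $\tau_0=0$, $\lim(\tau_i)=+\infty$, $0<\tau_{i+1}-\tau_i\le\delta$ for $i=0,1,\ldots$, for every $v_0\in C^1([0,1])$, $\bar x_0\in\mathbb{R}$ with $cv_0'(0)=\zeta\bar x_0$, $v_0(0)=0$, every $z_0\in C^0([-r,0];\mathbb{R}^2)$, $u\in C^0(\mathbb{R}_+;\mathbb{R})$ and $\xi\in L^\infty_{loc}(\mathbb{R}_+;\mathbb{R})$, the solution $(\bar x(t),v[t],z(t),w(t))$ of $( * )$ together with $$\dot z_1(t)=\zeta z_2(t)-\zeta z_2(t-r)\exp(-\zeta r)-\zeta z_1(t)-k_1(z_1(t)-w(t)),\quad t\ge0,$$ $$\dot z_2(t)=\theta(z_2(t))-(\mu+1)z_2(t)+\mu\zeta\int_0^1\int_{t-rl}^tz_2(s)\exp(-\zeta(t-s))ds\,dl+u(t)-k_2(z_1(t)-w(t)),\quad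 t\ge0,$$ $$\dot w(t)=\zeta z_2(t)-\zeta z_2(t-r)\exp(-\zeta r)-\zeta z_1(t),\quad t\in[\tau_i,\tau_{i+1}),$$ $$w(\tau_i)=\xi(\tau_i)+v(\tau_i,1),\quad i=0,1,\ldots,\qquad \hat x_t=z_t,\quad t\ge0,$$ $$\hat v(t,z)=\zeta\int_{t-rz}^t\exp(-\zeta(t-p))\hat x_2(p)dp,\quad t\ge0,\ z\in[0,1],$$ with initial condition $(\bar x_0,v_0,z_0)$, corresponding to inputs $u,\xi$, exists for all $t\ge0$ and satisfies for all $t\ge 0$ $$|\bar x(t)-\hat x_2(t)|+\|v[t]-\hat v[t]\|_\infty\le\exp(-\omega t)M\left(\|v_0\|_\infty+\|v_0'\|_\infty+|\bar x_0|+\|z_0\|\right)+P\sup_{0\le s\le t}\left(|\xi(s)|\exp(-\omega(t-s))\right).$$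
   Context: $v[t]$ denotes the profile $z\mapsto v(t,z)$; $\|v\|_\infty=\sup_{0\le z\le1}|v(z)|$ for $v\in C^0([0,1])$; $\|z\|=\max_{\theta\in[-r,0]}|z(\theta)|$ for $z\in C^0([-r,0];\mathbb{R}^2)$; $z_t(\theta)=z(t+\theta)$ for $\theta\in[-r,0]$. $z=(z_1,z_2)$ is the observer state, with initial history $z_0$ on $[-r,0]$, and $\hat x=(\hat x_1,\hat x_2)=(z_1,z_2)$. $L^\infty_{loc}(\mathbb{R}_+;\mathbb{R})$ is the class of Lebesgue measurable, locally bounded functions; suprema are actual suprema. The signal $w(t)\in\mathbb{R}$ is reset at each sampling time $\tau_i$ and evolves by its differential equation on $[\tau_i,\tau_{i+1})$. Solutions of $( * )$ are understood with $\bar x\in C^1(\mathbb{R}_+;\mathbb{R})$, $v\in C^1(\mathbb{R}_+\times[0,1])$. *)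

theory Defs
  imports "HOL-Analysis.Analysis"
begin

text \<open>
  Functions on a proper subset of the reals are total HOL functions of which only the values on that
  subset are used; at boundary points all derivatives are one-sided (``within'' the domain).
\<close>

definition C1_on :: "real set \<Rightarrow> (real \<Rightarrow> real) \<Rightarrow> bool" where
  "C1_on S f \<longleftrightarrow> f differentiable_on S \<and>
     continuous_on S (\<lambda>x. vector_derivative f (at x within S))"

abbreviation deriv01 :: "(real \<Rightarrow> real) \<Rightarrow> real \<Rightarrow> real" where
  "deriv01 f y \<equiv> vector_derivative f (at y within {0..1})"

definition sup_norm01 :: "(real \<Rightarrow> real) \<Rightarrow> real" where
  "sup_norm01 f = (SUP y\<in>{0..1}. \<bar>f y\<bar>)"

text \<open>The pointwise norm is the Euclidean one on the plane.\<close>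

definition history_norm :: "real \<Rightarrow> (real \<Rightarrow> real^2) \<Rightarrow> real" where
  "history_norm r z0 = (SUP s\<in>{-r..0}. norm (z0 s))"

definition Linf_loc :: "(real \<Rightarrow> real) \<Rightarrow> bool" where
  "Linf_loc \<xi> \<longleftrightarrow> \<xi> \<in> borel_measurable (lebesgue_on {0..}) \<and> (\<forall>T\<ge>0. bounded (\<xi> ` {0..T}))"

definition sampling_sequence :: "real \<Rightarrow> (nat \<Rightarrow> real) \<Rightarrow> bool" where
  "sampling_sequence \<delta> \<tau> \<longleftrightarrow> \<tau> 0 = 0 \<and> filterlim \<tau> at_top sequentially \<and>
     (\<forall>i. 0 < \<tau> (Suc i) - \<tau> i \<and> \<tau> (Suc i) - \<tau> i \<le> \<delta>)"

text \<open>
  In the reactor model, \<open>vt\<close> and \<open>vz\<close> are the partial derivatives of \<open>v\<close> in time and space; their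
  existence and joint continuity is the requirement that \<open>v\<close> be continuously differentiable on
  the closed strip.
\<close>

definition reactor_solution ::
  "real \<Rightarrow> real \<Rightarrow> real \<Rightarrow> (real \<Rightarrow> real) \<Rightarrow> (real \<Rightarrow> real) \<Rightarrow> real \<Rightarrow> (real \<Rightarrow> real)
     \<Rightarrow> (real \<Rightarrow> real) \<Rightarrow> (real \<Rightarrow> real \<Rightarrow> real) \<Rightarrow> bool" where
  "reactor_solution c \<mu> \<zeta> \<theta> u x0 v0 x v \<longleftrightarrow>
     C1_on {0..} x \<and>
     (\<forall>t\<ge>0. (x has_real_derivative
        \<theta> (x t) - (\<mu> + 1) * x t + \<mu> * integral {0..1} (v t) + u t) (at t within {0..})) \<and>
     (\<exists>vt vz.
        (\<forall>t\<ge>0. \<forall>y\<in>{0..1}.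
           ((\<lambda>s. v s y) has_real_derivative vt t y) (at t within {0..}) \<and>
           (v t has_real_derivative vz t y) (at y within {0..1}) \<and>
           vt t y + c * vz t y = - \<zeta> * v t y + \<zeta> * x t) \<and>
        continuous_on ({0..} \<times> {0..1}) (\<lambda>(t, y). vt t y) \<and>
        continuous_on ({0..} \<times> {0..1}) (\<lambda>(t, y). vz t y)) \<and>
     (\<forall>t\<ge>0. v t 0 = 0) \<and>
     x 0 = x0 \<and> (\<forall>y\<in>{0..1}. v 0 y = v0 y)"

text \<open>
  In the observer, the output \<open>y t\<close> stands for \<open>v(t,1)\<close>. Since \<open>w\<close> jumps at the sampling times, \<open>z\<close> is
  required to be continuous on the whole half-line and to satisfy its differential equations on
  each interval between consecutive sampling times, with the right derivative at its left end.
\<close>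

definition observer_solution ::
  "real \<Rightarrow> real \<Rightarrow> real \<Rightarrow> (real \<Rightarrow> real) \<Rightarrow> real \<Rightarrow> real \<Rightarrow> (nat \<Rightarrow> real)
     \<Rightarrow> (real \<Rightarrow> real) \<Rightarrow> (real \<Rightarrow> real) \<Rightarrow> (real \<Rightarrow> real) \<Rightarrow> (real \<Rightarrow> real^2)
     \<Rightarrow> (real \<Rightarrow> real^2) \<Rightarrow> (real \<Rightarrow> real) \<Rightarrow> bool" where
  "observer_solution r \<mu> \<zeta> \<theta> k1 k2 \<tau> u \<xi> y z0 z w \<longleftrightarrow>
     continuous_on {-r..} z \<and> (\<forall>s\<in>{-r..0}. z s = z0 s) \<and>
     (\<forall>i. \<forall>t\<in>{\<tau> i..<\<tau> (Suc i)}.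
        ((\<lambda>s. z s $ 1) has_real_derivative
           \<zeta> * z t $ 2 - \<zeta> * z (t - r) $ 2 * exp (- \<zeta> * r) - \<zeta> * z t $ 1 - k1 * (z t $ 1 - w t))
          (at t within {\<tau> i..<\<tau> (Suc i)}) \<and>
        ((\<lambda>s. z s $ 2) has_real_derivative
           \<theta> (z t $ 2) - (\<mu> + 1) * z t $ 2
           + \<mu> * \<zeta> * integral {0..1} (\<lambda>l. integral {t - r * l..t} (\<lambda>s. z s $ 2 * exp (- \<zeta> * (t - s))))
           + u t - k2 * (z t $ 1 - w t))
          (at t within {\<tau> i..<\<tau> (Suc i)}) \<and>
        (w has_real_derivative
           \<zeta> * z t $ 2 - \<zeta> * z (t - r) $ 2 * exp (- \<zeta> * r) - \<zeta> * z t $ 1)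
          (at t within {\<tau> i..<\<tau> (Suc i)})) \<and>
     (\<forall>i. w (\<tau> i) = \<xi> (\<tau> i) + y (\<tau> i))"

definition profile_estimate :: "real \<Rightarrow> real \<Rightarrow> (real \<Rightarrow> real^2) \<Rightarrow> real \<Rightarrow> real \<Rightarrow> real" where
  "profile_estimate r \<zeta> xhat t y =
     \<zeta> * integral {t - r * y..t} (\<lambda>p. exp (- \<zeta> * (t - p)) * xhat p $ 2)"

definition closed_loop_solution ::
  "real \<Rightarrow> real \<Rightarrow> real \<Rightarrow> real \<Rightarrow> (real \<Rightarrow> real) \<Rightarrow> real \<Rightarrow> real \<Rightarrow> (nat \<Rightarrow> real)
     \<Rightarrow> (real \<Rightarrow> real) \<Rightarrow> (real \<Rightarrow> real) \<Rightarrow> real \<Rightarrow> (real \<Rightarrow> real) \<Rightarrow> (real \<Rightarrow> real^2)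
     \<Rightarrow> (real \<Rightarrow> real) \<Rightarrow> (real \<Rightarrow> real \<Rightarrow> real) \<Rightarrow> (real \<Rightarrow> real^2) \<Rightarrow> (real \<Rightarrow> real) \<Rightarrow> bool" where
  "closed_loop_solution c r \<mu> \<zeta> \<theta> k1 k2 \<tau> u \<xi> x0 v0 z0 x v z w \<longleftrightarrow>
     reactor_solution c \<mu> \<zeta> \<theta> u x0 v0 x v \<and>
     observer_solution r \<mu> \<zeta> \<theta> k1 k2 \<tau> u \<xi> (\<lambda>t. v t 1) z0 z w"

end

theory Submission
  imports Defs
begin

text \<open>
  Solving the transport equation along its characteristics removes it. Suppose that the state \<open>x\<close>
  of the reactor is continued to \<open>[-r, 0]\<close> by the values that would have produced the profile \<open>v0\<close>;
  the compatibility condition at the inlet says that this continuation is continuous at \<open>0\<close>. Then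
  \<open>v(t, y)\<close> is the integral of \<open>\<zeta> exp (- \<zeta> (t - p)) x p\<close> over \<open>t - r y \<le> p \<le> t\<close>
  (lemmas \<open>reactor_solution_of_delay_equation\<close> and \<open>delay_equation_of_reactor_solution\<close>). Hence \<open>x\<close>
  solves a scalar delay equation, and the outlet value \<open>v(t, 1)\<close> satisfies
  \<open>y' = \<zeta> x(t) - \<zeta> exp (- \<zeta> r) x(t - r) - \<zeta> y\<close>. The observer is a copy of these two
  equations with an output injection.

  Existence and uniqueness are those of the equation \<open>X' = F X\<close> for a functional \<open>F\<close> that is causal
  and Lipschitz in the supremum norm of the past: the Picard iteration contracts by \<open>1/2\<close> in the
  norm weighted with \<open>exp (- 2 L t)\<close>, globally in time (locale \<open>causal_volterra\<close>). It is applied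
  once to the reactor and once to the observer; in the latter the sampled signal \<open>w\<close> is not an
  unknown, being the last sample plus the integral since then of a functional of \<open>z\<close>.

  For the decay, let \<open>e1\<close> and \<open>e2\<close> be the errors of the two observer components and \<open>\<eta>\<close> the
  difference of \<open>w\<close> and the outlet value. With gains \<open>k1 = lam \<zeta> + b - \<zeta>\<close> and \<open>k2 = b lam\<close>
  the combination \<open>p = e2 - lam e1\<close> turns the error equations into a loop of two damped scalar
  equations
  \<open>p' = - lam \<zeta> p + lam \<zeta> exp (- \<zeta> r) e2(t - r) + d - lam (lam \<zeta> - \<zeta>) \<eta>\<close> and
  \<open>e2' = - b e2 + b p + d + b lam \<eta>\<close>,
  where \<open>d\<close> is at most a constant multiple of the recent supremum of \<open>e2\<close>. For large \<open>lam\<close> and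
  \<open>b\<close> the term \<open>d\<close> is negligible against the damping and the gain of the loop is close to
  \<open>exp (- \<zeta> r) < 1\<close>: the delayed term is harmless because the reactor forgets at rate \<open>\<zeta>\<close>. Measuring
  the errors with the weight \<open>exp (\<omega> t)\<close> multiplies the delayed term by \<open>exp (\<omega> r)\<close>, so
  \<open>\<omega> = \<zeta>/2\<close> still leaves a gain below one. Finally \<open>\<eta>\<close> equals the noise at a sampling
  time and drifts with a speed bounded by the errors, hence contributes the noise and an extra
  gain of order \<open>\<delta>\<close>, which a short sampling period makes as small as required. Closing this
  small-gain argument gives \<open>error_decay\<close>; the profile error is the weighted integral of \<open>- e2\<close> over a
  window of length at most \<open>r\<close> and inherits the bound.
\<close>

section \<open>Causal Volterra equations with prescribed history\<close>

definition with_history :: "real \<Rightarrow> (real \<Rightarrow> 'a::real_normed_vector) \<Rightarrow> (real \<Rightarrow> 'a) \<Rightarrow> bool" where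
  "with_history r \<phi> X \<longleftrightarrow> continuous_on {-r..} X \<and> (\<forall>s\<in>{-r..0}. X s = \<phi> s)"

lemma continuous_on_halfline:
  fixes f :: "real \<Rightarrow> 'a::topological_space"
  assumes "\<And>T. continuous_on {a..T} f"
  shows "continuous_on {a..} f"
  unfolding continuous_on_eq_continuous_within
proof
  fix t assume t: "t \<in> {a..}"
  have "at t within {a..} = at t within {a..t + 1}"
    by (rule at_within_nhd[of _ "{..<t + 1}"]) auto
  moreover have "continuous (at t within {a..t + 1}) f"
    using assms[of "t + 1"] t by (auto simp: continuous_on_eq_continuous_within)
  ultimately show "continuous (at t within {a..}) f"
    by simp
qed

text \<open>
  Integrability is the right hypothesis on \<open>F X\<close> because the right-hand side of the observer jumps at
  the sampling times. In the Lipschitz condition two functions with the same history are compared,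
  so a bound on \<open>[0, s]\<close> controls their whole past.
\<close>
locale causal_volterra =
  fixes r L :: real and \<phi> :: "real \<Rightarrow> 'a::banach" and F :: "(real \<Rightarrow> 'a) \<Rightarrow> real \<Rightarrow> 'a"
  assumes r_nonneg: "0 \<le> r" and L_pos: "0 < L"
    and history_cont: "continuous_on {-r..0} \<phi>"
    and integrable: "\<And>X t. with_history r \<phi> X \<Longrightarrow> 0 \<le> t \<Longrightarrow> F X integrable_on {0..t}"
    and lipschitz: "\<And>X Y s B. with_history r \<phi> X \<Longrightarrow> with_history r \<phi> Y \<Longrightarrow> 0 \<le> s \<Longrightarrow>
      (\<And>p. p \<in> {0..s} \<Longrightarrow> norm (X p - Y p) \<le> B) \<Longrightarrow> norm (F X s - F Y s) \<le> L * B"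
begin

definition picard :: "(real \<Rightarrow> 'a) \<Rightarrow> real \<Rightarrow> 'a" where
  "picard X t = (if t \<le> 0 then \<phi> t else \<phi> 0 + integral {0..t} (F X))"

lemma picard_nonneg: "0 \<le> t \<Longrightarrow> picard X t = \<phi> 0 + integral {0..t} (F X)"
  by (cases "t = 0") (auto simp: picard_def)

lemma with_history_picard:
  assumes X: "with_history r \<phi> X"
  shows "with_history r \<phi> (picard X)"
proof -
  have "continuous_on {-r..T} (picard X)" for T
  proof (cases "0 \<le> T")
    case True
    have "continuous_on {0..T} (\<lambda>t. integral {0..t} (F X))"
      using integrable[OF X True] by (rule indefinite_integral_continuous_1)
    then have "continuous_on {0..T} (\<lambda>t. \<phi> 0 + integral {0..t} (F X))"
      by (intro continuous_intros)
    then have "continuous_on {0..T} (picard X)"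
      by (rule continuous_on_eq) (simp add: picard_nonneg)
    moreover have "continuous_on {-r..0} (picard X)"
      using history_cont by (rule continuous_on_eq) (simp add: picard_def)
    ultimately have "continuous_on ({-r..0} \<union> {0..T}) (picard X)"
      by (intro continuous_on_closed_Un) auto
    moreover have "{-r..0} \<union> {0..T} = {-r..T}" using True r_nonneg by auto
    ultimately show ?thesis by simp
  next
    case False
    then have "continuous_on {-r..T} \<phi>"
      by (intro continuous_on_subset[OF history_cont]) auto
    then show ?thesis
      by (rule continuous_on_eq) (use False in \<open>simp add: picard_def\<close>)
  qed
  then show ?thesis
    unfolding with_history_def by (auto intro: continuous_on_halfline simp: picard_def)
qed

text \<open>
  Integrating \<open>L B exp (2 L s)\<close> gains the factor \<open>1/2\<close>. The weight makes the estimate a contraction on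
  every interval \<open>[0, T]\<close> at once, so that no solution has to be continued step by step.
\<close>
lemma picard_contraction:
  assumes X: "with_history r \<phi> X" and Y: "with_history r \<phi> Y" and B: "0 \<le> B"
    and bound: "\<And>s. s \<in> {0..T} \<Longrightarrow> norm (X s - Y s) \<le> B * exp (2 * L * s)"
    and t: "t \<in> {0..T}"
  shows "norm (picard X t - picard Y t) \<le> B / 2 * exp (2 * L * t)"
proof -
  have t0: "0 \<le> t" using t by simp
  have diff: "picard X t - picard Y t = integral {0..t} (\<lambda>s. F X s - F Y s)"
    using t0 integrable[OF X t0] integrable[OF Y t0] by (simp add: picard_nonneg integral_diff)
  have exp_int: "((\<lambda>s. L * (B * exp (2 * L * s))) has_integral
      B / 2 * exp (2 * L * t) - B / 2 * exp (2 * L * 0)) {0..t}"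
    using L_pos t0
    by (intro fundamental_theorem_of_calculus)
      (auto simp: has_real_derivative_iff_has_vector_derivative[symmetric]
        intro!: derivative_eq_intros)
  have "norm (integral {0..t} (\<lambda>s. F X s - F Y s)) \<le> integral {0..t} (\<lambda>s. L * (B * exp (2 * L * s)))"
  proof (rule integral_norm_bound_integral)
    show "(\<lambda>s. F X s - F Y s) integrable_on {0..t}"
      using integrable[OF X t0] integrable[OF Y t0] by (rule integrable_diff)
    show "(\<lambda>s. L * (B * exp (2 * L * s))) integrable_on {0..t}"
      using exp_int by blast
    fix s assume s: "s \<in> {0..t}"
    show "norm (F X s - F Y s) \<le> L * (B * exp (2 * L * s))"
    proof (rule lipschitz[OF X Y])
      fix p assume p: "p \<in> {0..s}"
      then have "norm (X p - Y p) \<le> B * exp (2 * L * p)" using s t by (intro bound) auto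
      also have "\<dots> \<le> B * exp (2 * L * s)"
        using p L_pos B by (intro mult_left_mono) auto
      finally show "norm (X p - Y p) \<le> B * exp (2 * L * s)" .
    qed (use s in auto)
  qed
  also have "\<dots> = B / 2 * exp (2 * L * t) - B / 2"
    using integral_unique[OF exp_int] by (simp only: mult_zero_right exp_zero mult_1_right)
  also have "\<dots> \<le> B / 2 * exp (2 * L * t)" using B by simp
  finally show ?thesis by (simp add: diff)
qed

lemma with_history_agree_on_past:
  assumes "with_history r \<phi> X" "with_history r \<phi> Y" "t \<in> {-r..0}"
  shows "X t = Y t"
  using assms by (simp add: with_history_def)

lemma gap_bounded:
  assumes X: "with_history r \<phi> X" and Y: "with_history r \<phi> Y"
  obtains B where "0 \<le> B" "\<And>s. s \<in> {0..T} \<Longrightarrow> norm (X s - Y s) \<le> B"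
proof -
  have "continuous_on {0..T} (\<lambda>s. norm (X s - Y s))"
    using X Y r_nonneg unfolding with_history_def
    by (intro continuous_intros) (auto elim!: continuous_on_subset)
  then have "bounded ((\<lambda>s. norm (X s - Y s)) ` {0..T})"
    by (intro compact_imp_bounded compact_continuous_image) auto
  then obtain B where "\<forall>s\<in>{0..T}. norm (X s - Y s) \<le> B"
    by (auto simp: bounded_real)
  then have "norm (X s - Y s) \<le> max B 0" if "s \<in> {0..T}" for s
    using that \<open>\<forall>s\<in>{0..T}. norm (X s - Y s) \<le> B\<close> by (meson max.coboundedI1)
  then show ?thesis using that[of "max B 0"] by simp
qed

text \<open>
  Two solutions are fixed points of the Picard operator, so the contraction can be applied to their
  difference arbitrarily often.
\<close>
lemma solution_unique:
  assumes X: "with_history r \<phi> X" "\<And>t. 0 \<le> t \<Longrightarrow> X t = \<phi> 0 + integral {0..t} (F X)"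
    and Y: "with_history r \<phi> Y" "\<And>t. 0 \<le> t \<Longrightarrow> Y t = \<phi> 0 + integral {0..t} (F Y)"
    and t: "-r \<le> t"
  shows "X t = Y t"
proof (cases "0 \<le> t")
  case True
  obtain B where B: "0 \<le> B" "\<And>s. s \<in> {0..t} \<Longrightarrow> norm (X s - Y s) \<le> B"
    using gap_bounded[OF X(1) Y(1)] by blast
  have contr: "\<forall>s\<in>{0..t}. norm (X s - Y s) \<le> B / 2 ^ n * exp (2 * L * s)" for n
  proof (induction n)
    case 0
    show ?case
    proof
      fix s assume s: "s \<in> {0..t}"
      have "B * 1 \<le> B * exp (2 * L * s)"
        using B s L_pos by (intro mult_left_mono) auto
      then show "norm (X s - Y s) \<le> B / 2 ^ 0 * exp (2 * L * s)" using B(2)[OF s] by simp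
    qed
  next
    case (Suc n)
    show ?case
    proof
      fix s assume s: "s \<in> {0..t}"
      have "norm (picard X s - picard Y s) \<le> B / 2 ^ n / 2 * exp (2 * L * s)"
        using Suc B s by (intro picard_contraction[OF X(1) Y(1), of _ t]) auto
      then show "norm (X s - Y s) \<le> B / 2 ^ Suc n * exp (2 * L * s)"
        using s X(2)[of s] Y(2)[of s] by (simp add: picard_nonneg field_simps)
    qed
  qed
  have "(\<lambda>n. B * exp (2 * L * t) * (1 / 2) ^ n) \<longlonglongrightarrow> B * exp (2 * L * t) * 0"
    by (intro tendsto_intros LIMSEQ_power_zero) auto
  from LIMSEQ_le_const[OF this, of "norm (X t - Y t)"] have "norm (X t - Y t) \<le> 0"
    using contr True by (auto simp: power_divide)
  then show ?thesis by simp
qed (use t with_history_agree_on_past[OF X(1) Y(1)] in auto)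

text \<open>
  The iterates starting from the constant continuation of the history converge uniformly on every
  bounded interval, because their increments are dominated by a geometric series.
\<close>
lemma solution_exists:
  obtains X where "with_history r \<phi> X" "\<And>t. 0 \<le> t \<Longrightarrow> X t = \<phi> 0 + integral {0..t} (F X)"
proof -
  define Z where "Z n = (picard ^^ n) (\<lambda>t. \<phi> (min t 0))" for n
  have Z_Suc: "Z (Suc n) = picard (Z n)" for n by (simp add: Z_def)
  have "with_history r \<phi> (\<lambda>t. \<phi> (min t 0))"
    unfolding with_history_def
    by (auto intro!: continuous_on_compose2[OF history_cont] continuous_intros
        simp: r_nonneg)
  then have Z: "with_history r \<phi> (Z n)" for n
    by (induction n) (simp_all add: Z_Suc with_history_picard, simp add: Z_def)
  define X where "X t = Z 0 t + (\<Sum>i. Z (Suc i) t - Z i t)" for t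
  have unif: "uniform_limit {-r..T} Z X sequentially" for T
  proof -
    obtain B where B: "0 \<le> B" "\<And>s. s \<in> {0..T} \<Longrightarrow> norm (Z 1 s - Z 0 s) \<le> B"
      using gap_bounded[OF Z Z] by blast
    have gap: "\<forall>s\<in>{0..T}. norm (Z (Suc n) s - Z n s) \<le> B / 2 ^ n * exp (2 * L * s)" for n
    proof (induction n)
      case 0
      show ?case
      proof
        fix s assume s: "s \<in> {0..T}"
        have "B * 1 \<le> B * exp (2 * L * s)"
          using B s L_pos by (intro mult_left_mono) auto
        then show "norm (Z (Suc 0) s - Z 0 s) \<le> B / 2 ^ 0 * exp (2 * L * s)"
          using B(2)[OF s] by simp
      qed
    next
      case (Suc n)
      show ?case
      proof
        fix s assume s: "s \<in> {0..T}"
        have "norm (picard (Z (Suc n)) s - picard (Z n) s) \<le> B / 2 ^ n / 2 * exp (2 * L * s)"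
          using Suc B s by (intro picard_contraction[OF Z Z, of _ T]) auto
        then show "norm (Z (Suc (Suc n)) s - Z (Suc n) s) \<le> B / 2 ^ Suc n * exp (2 * L * s)"
          using s by (simp add: Z_Suc field_simps)
      qed
    qed
    have "uniform_limit {-r..T} (\<lambda>n t. \<Sum>i<n. Z (Suc i) t - Z i t)
        (\<lambda>t. \<Sum>i. Z (Suc i) t - Z i t) sequentially"
    proof (rule Weierstrass_m_test)
      show "summable (\<lambda>n. B * exp (2 * L * T) * (1 / 2) ^ n)"
        by (intro summable_mult summable_geometric) auto
      fix n t assume t: "t \<in> {-r..T}"
      show "norm (Z (Suc n) t - Z n t) \<le> B * exp (2 * L * T) * (1 / 2) ^ n"
      proof (cases "0 \<le> t")
        case True
        have "norm (Z (Suc n) t - Z n t) \<le> B / 2 ^ n * exp (2 * L * t)"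
          using gap t True by auto
        also have "\<dots> \<le> B / 2 ^ n * exp (2 * L * T)"
          using B t L_pos by (intro mult_left_mono) auto
        finally show ?thesis by (simp add: power_divide)
      next
        case False
        then have "Z (Suc n) t = Z n t"
          using t by (intro with_history_agree_on_past[OF Z Z]) auto
        then show ?thesis using B by simp
      qed
    qed
    from uniform_limit_add[OF uniform_limit_const this, of "Z 0"]
    have "uniform_limit {-r..T} (\<lambda>n t. Z 0 t + (\<Sum>i<n. Z (Suc i) t - Z i t)) X sequentially"
      by (simp add: X_def[abs_def])
    moreover have "Z 0 t + (\<Sum>i<n. Z (Suc i) t - Z i t) = Z n t" for n t
      by (simp add: sum_lessThan_telescope[of "\<lambda>i. Z i t"])
    ultimately show ?thesis by simp
  qed
  have X: "with_history r \<phi> X"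
    unfolding with_history_def
  proof (intro conjI ballI)
    have "continuous_on {-r..T} X" for T
    proof (rule uniform_limit_theorem[OF _ unif])
      have "continuous_on {-r..T} (Z n)" for n
        by (rule continuous_on_subset[of "{-r..}"]) (use Z in \<open>auto simp: with_history_def\<close>)
      then show "\<forall>\<^sub>F n in sequentially. continuous_on {-r..T} (Z n)" by simp
    qed simp
    then show "continuous_on {-r..} X" by (rule continuous_on_halfline)
    fix s assume s: "s \<in> {-r..0}"
    then have "(\<lambda>n. Z n s) \<longlonglongrightarrow> X s" by (intro tendsto_uniform_limitI[OF unif])
    moreover have "(\<lambda>n. Z n s) = (\<lambda>n. \<phi> s)" using Z s by (auto simp: with_history_def)
    ultimately show "X s = \<phi> s" by (simp add: LIMSEQ_const_iff)
  qed
  have "X t = \<phi> 0 + integral {0..t} (F X)" if t: "0 \<le> t" for t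
  proof -
    have "(\<lambda>n. Z (Suc n) t) \<longlonglongrightarrow> X t"
      using t r_nonneg by (intro LIMSEQ_Suc tendsto_uniform_limitI[OF unif[of t]]) auto
    moreover have "(\<lambda>n. Z (Suc n) t) \<longlonglongrightarrow> picard X t"
    proof (rule tendstoI)
      fix e :: real assume e: "0 < e"
      define d where "d = e * exp (- (2 * L * t))"
      have "d > 0" using e by (simp add: d_def)
      from uniform_limitD[OF unif[of t] this]
      show "\<forall>\<^sub>F n in sequentially. dist (Z (Suc n) t) (picard X t) < e"
      proof eventually_elim
        fix n assume n: "\<forall>s\<in>{-r..t}. dist (Z n s) (X s) < d"
        have "norm (picard (Z n) t - picard X t) \<le> d / 2 * exp (2 * L * t)"
        proof (rule picard_contraction[OF Z X, of _ t])
          fix s assume s: "s \<in> {0..t}"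
          have "norm (Z n s - X s) \<le> d * 1" using n s r_nonneg by (simp add: dist_norm less_imp_le)
          also have "\<dots> \<le> d * exp (2 * L * s)"
            using s L_pos \<open>d > 0\<close> by (intro mult_left_mono) auto
          finally show "norm (Z n s - X s) \<le> d * exp (2 * L * s)" .
        qed (use \<open>d > 0\<close> t in auto)
        also have "\<dots> = e / 2" by (simp add: d_def exp_minus)
        finally show "dist (Z (Suc n) t) (picard X t) < e"
          using e by (simp add: Z_Suc dist_norm)
      qed
    qed
    ultimately have "X t = picard X t" by (rule LIMSEQ_unique)
    then show ?thesis using t by (simp add: picard_nonneg)
  qed
  with X show ?thesis by (rule that)
qed

end

section \<open>The transport equation as a distributed delay\<close>

lemma has_real_derivative_compose_within:
  fixes f g :: "real \<Rightarrow> real"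
  assumes "(f has_real_derivative D) (at (g x) within T)" "g ` S \<subseteq> T"
    and "(g has_real_derivative E) (at x within S)"
  shows "((\<lambda>x. f (g x)) has_real_derivative D * E) (at x within S)"
  using DERIV_image_chain[OF has_field_derivative_subset[OF assms(1,2)] assms(3)]
  by (simp add: o_def)

lemma integral_has_derivative_halfline:
  fixes f :: "real \<Rightarrow> real"
  assumes f: "continuous_on {a..} f" and t: "a \<le> t"
  shows "((\<lambda>t. integral {a..t} f) has_real_derivative f t) (at t within {a..})"
proof -
  have "continuous_on {a..t + 1} f" by (rule continuous_on_subset[OF f]) auto
  then have "((\<lambda>t. integral {a..t} f) has_real_derivative f t) (at t within {a..t + 1})"
    using t by (intro integral_has_real_derivative) auto
  moreover have "at t within {a..} = at t within {a..t + 1}"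
    by (rule at_within_nhd[of _ "{..<t + 1}"]) auto
  ultimately show ?thesis by simp
qed

locale transport_delay =
  fixes c r \<zeta> :: real
  assumes c_pos: "0 < c" and zeta_pos: "0 < \<zeta>" and r_eq: "r = inverse c"
begin

lemma r_pos: "0 < r" using c_pos by (simp add: r_eq)

text \<open>
  The solution of the transport equation with input \<open>q\<close>, obtained along the characteristics. As a
  function of \<open>y\<close> it is also the profile estimate formed from an observed input.
\<close>
definition memory :: "(real \<Rightarrow> real) \<Rightarrow> real \<Rightarrow> real \<Rightarrow> real" where
  "memory q t y = \<zeta> * integral {t - r * y..t} (\<lambda>p. exp (- \<zeta> * (t - p)) * q p)"

text \<open>
  Taking the factor \<open>exp (- \<zeta> t)\<close> out of the integral leaves a difference of two values of one
  primitive; smoothness of \<open>memory\<close> in both variables can be read off from this form.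
\<close>
definition primitive :: "(real \<Rightarrow> real) \<Rightarrow> real \<Rightarrow> real" where
  "primitive q s = integral {-r..s} (\<lambda>p. exp (\<zeta> * p) * q p)"

lemma delay_window: "y \<in> {0..1} \<Longrightarrow> 0 \<le> r * y \<and> r * y \<le> r"
  using r_pos by (simp add: mult_left_le)

lemma primitive_has_derivative:
  assumes q: "continuous_on {-r..} q" and s: "-r \<le> s"
  shows "(primitive q has_real_derivative exp (\<zeta> * s) * q s) (at s within {-r..})"
  unfolding primitive_def
  by (rule integral_has_derivative_halfline[OF _ s]) (intro continuous_intros q)

lemma continuous_on_primitive:
  "continuous_on {-r..} q \<Longrightarrow> continuous_on {-r..} (primitive q)"
  by (rule DERIV_continuous_on) (auto intro: primitive_has_derivative)

lemma memory_eq_primitive: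
  assumes q: "continuous_on {-r..} q" and t: "0 \<le> t" and y: "y \<in> {0..1}"
  shows "memory q t y = \<zeta> * exp (- \<zeta> * t) * (primitive q t - primitive q (t - r * y))"
proof -
  have int: "(\<lambda>p. exp (\<zeta> * p) * q p) integrable_on {-r..t}"
    by (intro integrable_continuous_real continuous_intros continuous_on_subset[OF q]) auto
  have "integral {-r..t - r * y} (\<lambda>p. exp (\<zeta> * p) * q p)
      + integral {t - r * y..t} (\<lambda>p. exp (\<zeta> * p) * q p) = primitive q t"
    unfolding primitive_def using delay_window[OF y] t
    by (intro Henstock_Kurzweil_Integration.integral_combine int) auto
  moreover have "integral {t - r * y..t} (\<lambda>p. exp (- \<zeta> * (t - p)) * q p)
      = exp (- \<zeta> * t) * integral {t - r * y..t} (\<lambda>p. exp (\<zeta> * p) * q p)"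
    by (subst integral_mult_right[symmetric]) (simp add: algebra_simps flip: exp_add)
  ultimately show ?thesis
    by (simp add: memory_def primitive_def eq_diff_eq')
qed

lemma memory_has_derivative_time:
  assumes q: "continuous_on {-r..} q" and t: "0 \<le> t" and y: "y \<in> {0..1}"
  shows "((\<lambda>s. memory q s y) has_real_derivative
    \<zeta> * q t - \<zeta> * exp (- \<zeta> * (r * y)) * q (t - r * y) - \<zeta> * memory q t y) (at t within {0..})"
proof -
  note window = delay_window[OF y]
  have now: "(primitive q has_real_derivative exp (\<zeta> * t) * q t) (at t within {0..})"
    using t r_pos by (intro has_field_derivative_subset[OF primitive_has_derivative[OF q]]) auto
  have past: "((\<lambda>s. primitive q (s - r * y)) has_real_derivative
      exp (\<zeta> * (t - r * y)) * q (t - r * y) * 1) (at t within {0..})"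
  proof (rule has_real_derivative_compose_within[OF primitive_has_derivative[OF q]])
    show "((\<lambda>s. s - r * y) has_real_derivative 1) (at t within {0..})"
      by (rule derivative_eq_intros refl | simp)+
  qed (use window t in auto)
  have "((\<lambda>s. \<zeta> * exp (- \<zeta> * s) * (primitive q s - primitive q (s - r * y))) has_real_derivative
      - \<zeta> * (\<zeta> * exp (- \<zeta> * t)) * (primitive q t - primitive q (t - r * y))
      + \<zeta> * exp (- \<zeta> * t) * (exp (\<zeta> * t) * q t - exp (\<zeta> * (t - r * y)) * q (t - r * y)))
      (at t within {0..})"
    by (rule derivative_eq_intros now past refl | simp)+
  also have "- \<zeta> * (\<zeta> * exp (- \<zeta> * t)) * (primitive q t - primitive q (t - r * y))
      = - \<zeta> * memory q t y"
    by (simp add: memory_eq_primitive[OF q t y])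
  also have "\<zeta> * exp (- \<zeta> * t) * (exp (\<zeta> * t) * q t - exp (\<zeta> * (t - r * y)) * q (t - r * y))
      = \<zeta> * q t - \<zeta> * exp (- \<zeta> * (r * y)) * q (t - r * y)"
    by (simp add: exp_diff exp_minus field_simps)
  finally show ?thesis
    by (rule has_field_derivative_transform_within[where d=1, THEN DERIV_cong])
      (use t in \<open>simp_all add: memory_eq_primitive[OF q _ y]\<close>)
qed

lemma memory_has_derivative_space:
  assumes q: "continuous_on {-r..} q" and t: "0 \<le> t" and y: "y \<in> {0..1}"
  shows "(memory q t has_real_derivative \<zeta> * r * exp (- \<zeta> * (r * y)) * q (t - r * y))
    (at y within {0..1})"
proof -
  have past: "((\<lambda>y. primitive q (t - r * y)) has_real_derivative
      exp (\<zeta> * (t - r * y)) * q (t - r * y) * (- r)) (at y within {0..1})"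
  proof (rule has_real_derivative_compose_within[OF primitive_has_derivative[OF q]])
    show "((\<lambda>y. t - r * y) has_real_derivative - r) (at y within {0..1})"
      by (rule derivative_eq_intros refl | simp)+
  qed (use delay_window y t in force)+
  have "((\<lambda>y. \<zeta> * exp (- \<zeta> * t) * (primitive q t - primitive q (t - r * y))) has_real_derivative
      \<zeta> * exp (- \<zeta> * t) * (0 - exp (\<zeta> * (t - r * y)) * q (t - r * y) * (- r))) (at y within {0..1})"
    by (rule derivative_eq_intros past refl | simp)+
  also have "\<zeta> * exp (- \<zeta> * t) * (0 - exp (\<zeta> * (t - r * y)) * q (t - r * y) * (- r))
      = \<zeta> * r * exp (- \<zeta> * (r * y)) * q (t - r * y)"
    by (simp add: exp_diff exp_minus field_simps)
  finally show ?thesis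
    by (rule has_field_derivative_transform_within[where d=1])
      (use y in \<open>simp_all add: memory_eq_primitive[OF q t]\<close>)
qed

lemma continuous_on_delayed:
  assumes q: "continuous_on {-r..} q"
  shows "continuous_on ({0..} \<times> {0..1}) (\<lambda>(t, y). q (t - r * y))"
  unfolding case_prod_unfold
  by (rule continuous_on_compose2[OF q])
    (use delay_window in \<open>fastforce intro!: continuous_intros\<close>)+

lemma continuous_on_memory:
  assumes q: "continuous_on {-r..} q"
  shows "continuous_on ({0..} \<times> {0..1}) (\<lambda>(t, y). memory q t y)"
proof -
  have "continuous_on ({0..} \<times> {0..1}) (\<lambda>z. primitive q (fst z))"
    using r_pos
    by (intro continuous_on_compose2[OF continuous_on_primitive[OF q]] continuous_intros) auto
  moreover have "continuous_on ({0..} \<times> {0..1}) (\<lambda>z. primitive q (fst z - r * snd z))"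
    using continuous_on_delayed[OF continuous_on_primitive[OF q]] by (simp add: case_prod_beta)
  ultimately have "continuous_on ({0..} \<times> {0..1}) (\<lambda>z. \<zeta> * exp (- \<zeta> * fst z)
      * (primitive q (fst z) - primitive q (fst z - r * snd z)))"
    by (intro continuous_intros)
  then show ?thesis
    by (rule continuous_on_eq) (auto simp: memory_eq_primitive[OF q])
qed

lemma continuous_on_memory_space:
  assumes q: "continuous_on {-r..} q" and t: "0 \<le> t"
  shows "continuous_on {0..1} (memory q t)"
  by (rule DERIV_continuous_on) (auto intro: memory_has_derivative_space[OF q t])

lemma memory_boundary [simp]: "memory q t 0 = 0"
  by (simp add: memory_def)

lemma memory_diff:
  assumes q: "continuous_on {-r..} q" "continuous_on {-r..} q'" and t: "0 \<le> t" and y: "y \<in> {0..1}"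
  shows "memory q t y - memory q' t y = memory (\<lambda>s. q s - q' s) t y"
proof -
  have int: "(\<lambda>p. exp (- \<zeta> * (t - p)) * q p) integrable_on {t - r * y..t}"
    if "continuous_on {-r..} q" for q
    using delay_window[OF y] t
    by (intro integrable_continuous_real continuous_intros continuous_on_subset[OF that]) auto
  show ?thesis
    using integral_diff[OF int[OF q(1)] int[OF q(2)]]
    by (simp add: memory_def flip: right_diff_distrib)
qed

lemma memory_cong:
  assumes "\<And>s. -r \<le> s \<Longrightarrow> q s = q' s" and "0 \<le> t" and y: "y \<in> {0..1}"
  shows "memory q t y = memory q' t y"
proof -
  have "integral {t - r * y..t} (\<lambda>p. exp (- \<zeta> * (t - p)) * q p)
      = integral {t - r * y..t} (\<lambda>p. exp (- \<zeta> * (t - p)) * q' p)"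
  proof (rule integral_cong)
    fix p assume "p \<in> {t - r * y..t}"
    then have "-r \<le> p" using assms(2) delay_window[OF y] by simp
    then show "exp (- \<zeta> * (t - p)) * q p = exp (- \<zeta> * (t - p)) * q' p"
      by (simp add: assms(1))
  qed
  then show ?thesis by (simp add: memory_def)
qed

text \<open>
  The kernel is at most \<open>1\<close> and the window has length at most \<open>r\<close>.
\<close>
lemma memory_bound:
  assumes q: "continuous_on {-r..} q" and t: "0 \<le> t" and y: "y \<in> {0..1}"
    and B: "\<And>s. s \<in> {t - r..t} \<Longrightarrow> \<bar>q s\<bar> \<le> B"
  shows "\<bar>memory q t y\<bar> \<le> \<zeta> * r * B"
proof -
  note window = delay_window[OF y]
  have B0: "0 \<le> B" using B[of t] r_pos by simp
  have "norm (integral {t - r * y..t} (\<lambda>p. exp (- \<zeta> * (t - p)) * q p)) \<le> B * (t - (t - r * y))"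
  proof (rule integral_bound)
    show "continuous_on {t - r * y..t} (\<lambda>p. exp (- \<zeta> * (t - p)) * q p)"
      using window t by (intro continuous_intros continuous_on_subset[OF q]) auto
    fix p assume p: "p \<in> {t - r * y..t}"
    have "\<bar>exp (- \<zeta> * (t - p)) * q p\<bar> \<le> 1 * B"
      unfolding abs_mult using p window zeta_pos by (intro mult_mono B) auto
    then show "norm (exp (- \<zeta> * (t - p)) * q p) \<le> B" by simp
  qed (use window in auto)
  also have "\<dots> \<le> B * r" using window B0 by (intro mult_left_mono) auto
  finally show ?thesis
    using zeta_pos by (simp add: memory_def abs_mult mult.commute mult.left_commute)
qed

lemma continuous_on_mean_memory:
  assumes q: "continuous_on {-r..} q"
  shows "continuous_on {0..} (\<lambda>t. integral {0..1} (memory q t))"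
  using integral_continuous_on_param[of "{0..}" "0::real" 1 "memory q"] continuous_on_memory[OF q]
  by simp

lemma mean_memory_diff_bound:
  assumes q: "continuous_on {-r..} q" "continuous_on {-r..} q'" and t: "0 \<le> t"
    and B: "\<And>s. s \<in> {t - r..t} \<Longrightarrow> \<bar>q s - q' s\<bar> \<le> B"
  shows "\<bar>integral {0..1} (memory q t) - integral {0..1} (memory q' t)\<bar> \<le> \<zeta> * r * B"
proof -
  note cont = continuous_on_memory_space[OF q(1) t] continuous_on_memory_space[OF q(2) t]
  have "norm (integral {0..1} (\<lambda>y. memory q t y - memory q' t y)) \<le> \<zeta> * r * B * (1 - 0)"
  proof (rule integral_bound)
    show "continuous_on {0..1} (\<lambda>y. memory q t y - memory q' t y)"
      by (intro continuous_intros cont)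
    show "norm (memory q t y - memory q' t y) \<le> \<zeta> * r * B" if "y \<in> {0..1}" for y
      using memory_bound[OF _ t that, of "\<lambda>s. q s - q' s" B] q B
      by (simp add: memory_diff[OF q t that] continuous_on_diff)
  qed auto
  then show ?thesis
    using cont by (simp add: integral_diff integrable_continuous_real)
qed

end

text \<open>
  Multiplied by \<open>exp (\<zeta> s)\<close>, a solution is constant along each characteristic. Followed backwards, a
  characteristic meets either the inlet or the initial line, where the data vanish. Applied to a
  difference, this is uniqueness for the transport equation.
\<close>
lemma transport_equation_zero_data:
  fixes c \<zeta> :: real and d dt dy :: "real \<Rightarrow> real \<Rightarrow> real"
  assumes c: "0 < c"
    and dt: "\<And>t y. 0 \<le> t \<Longrightarrow> y \<in> {0..1} \<Longrightarrow>
      ((\<lambda>s. d s y) has_real_derivative dt t y) (at t within {0..})"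
    and dy: "\<And>t y. 0 \<le> t \<Longrightarrow> y \<in> {0..1} \<Longrightarrow>
      (d t has_real_derivative dy t y) (at y within {0..1})"
    and eq: "\<And>t y. 0 \<le> t \<Longrightarrow> y \<in> {0..1} \<Longrightarrow> dt t y + c * dy t y = - \<zeta> * d t y"
    and cont: "continuous_on ({0..} \<times> {0..1}) (\<lambda>(t, y). dy t y)"
    and boundary: "\<And>t. 0 \<le> t \<Longrightarrow> d t 0 = 0" and initial: "\<And>y. y \<in> {0..1} \<Longrightarrow> d 0 y = 0"
    and t: "0 \<le> t" and y: "y \<in> {0..1}"
  shows "d t y = 0"
proof -
  \<comment> \<open>The time at which the characteristic through \<open>(t, y)\<close> enters the strip.\<close>
  define s0 where "s0 = max 0 (t - y / c)"
  define a where "a s = y + c * (s - t)" for s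
  have s0: "0 \<le> s0" "s0 \<le> t" using t y c by (auto simp: s0_def)
  have a: "a s \<in> {0..1}" if "s \<in> {s0..t}" for s
  proof -
    have "t - y / c \<le> s" using that by (simp add: s0_def)
    then have "c * (t - y / c) \<le> c * s" using c by (intro mult_left_mono) auto
    then have "0 \<le> a s" using c by (simp add: a_def algebra_simps)
    moreover have "c * (s - t) \<le> 0" using that c by (simp add: mult_nonneg_nonpos)
    ultimately show ?thesis using y by (simp add: a_def)
  qed
  have total: "((\<lambda>s. d s (a s)) has_real_derivative dt s (a s) + c * dy s (a s))
      (at s within {s0..t})" if s: "s \<in> {s0..t}" for s
  proof -
    have s_nonneg: "0 \<le> s" using s s0 by simp
    have "((\<lambda>(t, y). d t y) has_derivative
        (\<lambda>(tx, ty). dt s (a s) * tx + blinfun_mult_right (dy s (a s)) ty))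
        (at (s, a s) within {0..} \<times> {0..1})"
    proof (rule has_derivative_partialsI)
      show "((\<lambda>s'. d s' (a s)) has_derivative (*) (dt s (a s))) (at s within {0..})"
        using dt[OF s_nonneg a[OF s]] by (simp add: has_field_derivative_def)
      show "(d x has_derivative blinfun_apply (blinfun_mult_right (dy x y))) (at y within {0..1})"
        if "x \<in> {0..}" "y \<in> {0..1}" for x y
        using dy[of x y] that
        by (simp add: has_field_derivative_def blinfun_mult_right.rep_eq)
      have "continuous_on ({0..} \<times> {0..1}) (\<lambda>z. blinfun_mult_right (dy (fst z) (snd z)))"
        using cont bounded_linear.continuous_on[OF bounded_linear_blinfun_mult_right]
        by (simp add: case_prod_unfold)
      then show "continuous (at (s, a s) within {0..} \<times> {0..1})
          (\<lambda>(x, y). blinfun_mult_right (dy x y))"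
        using s_nonneg a[OF s] by (simp add: continuous_on_eq_continuous_within case_prod_unfold)
    qed (use a[OF s] in auto)
    then have D: "((\<lambda>(t, y). d t y) has_derivative
        (\<lambda>(tx, ty). dt s (a s) * tx + blinfun_mult_right (dy s (a s)) ty))
        (at (s, a s) within (\<lambda>s. (s, a s)) ` {s0..t})"
      by (rule has_derivative_subset) (use a s0 in auto)
    have "((\<lambda>s. (s, a s)) has_derivative (\<lambda>h. (h, c * h))) (at s within {s0..t})"
      unfolding a_def by (auto intro!: derivative_eq_intros)
    from has_derivative_in_compose[OF this D]
    have "((\<lambda>s. d s (a s)) has_derivative (\<lambda>h. dt s (a s) * h + dy s (a s) * (c * h)))
        (at s within {s0..t})"
      by (simp add: blinfun_mult_right.rep_eq)
    also have "(\<lambda>h. dt s (a s) * h + dy s (a s) * (c * h)) = (*) (dt s (a s) + c * dy s (a s))"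
      by (auto simp: algebra_simps)
    finally show ?thesis by (simp add: has_field_derivative_def)
  qed
  have "((\<lambda>s. exp (\<zeta> * s) * d s (a s)) has_real_derivative 0) (at s within {s0..t})"
    if s: "s \<in> {s0..t}" for s
  proof -
    have "((\<lambda>s. exp (\<zeta> * s) * d s (a s)) has_real_derivative
        exp (\<zeta> * s) * \<zeta> * d s (a s) + exp (\<zeta> * s) * (dt s (a s) + c * dy s (a s)))
        (at s within {s0..t})"
      by (rule derivative_eq_intros total[OF s] refl | simp)+
    moreover have "dt s (a s) + c * dy s (a s) = - \<zeta> * d s (a s)"
      using s s0 a[OF s] by (intro eq) auto
    ultimately show ?thesis by simp
  qed
  from has_field_derivative_zero_constant[OF _ this]
  obtain k where k: "\<And>s. s \<in> {s0..t} \<Longrightarrow> exp (\<zeta> * s) * d s (a s) = k" by auto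
  have "d s0 (a s0) = 0"
  proof (cases "t \<le> y / c")
    case True
    then show ?thesis using initial[OF a[of s0]] s0 by (simp add: s0_def)
  next
    case False
    then have "a s0 = 0" using c by (simp add: s0_def a_def)
    then show ?thesis using boundary[OF s0(1)] by simp
  qed
  then show ?thesis
    using k[of s0] k[of t] s0 by (simp add: a_def)
qed

section \<open>Reduction of the reactor to a delay equation\<close>

context transport_delay
begin

text \<open>
  The past values of the input that generate the initial profile: differentiating \<open>memory q 0 y = v0 y\<close>
  in \<open>y\<close> gives \<open>\<zeta> r exp (- \<zeta> r y) q (- r y) = v0' y\<close>, to be solved for \<open>q\<close>.
\<close>
definition past_input :: "(real \<Rightarrow> real) \<Rightarrow> real \<Rightarrow> real" where
  "past_input v0 s = c / \<zeta> * exp (- \<zeta> * s) * deriv01 v0 (- (c * s))"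

lemma past_window: "s \<in> {-r..0} \<Longrightarrow> - (c * s) \<in> {0..1}"
proof -
  assume s: "s \<in> {-r..0}"
  then have "c * (-r) \<le> c * s" "c * s \<le> 0"
    using c_pos by (intro mult_left_mono mult_nonneg_nonpos; simp)+
  then show "- (c * s) \<in> {0..1}" using c_pos by (simp add: r_eq)
qed

lemma continuous_on_past_input:
  assumes "C1_on {0..1} v0"
  shows "continuous_on {-r..0} (past_input v0)"
proof -
  have "continuous_on {-r..0} (\<lambda>s. deriv01 v0 (- (c * s)))"
  proof (rule continuous_on_compose2[where g = "deriv01 v0" and t = "{0..1}"])
    show "continuous_on {0..1} (deriv01 v0)" using assms by (simp add: C1_on_def)
    show "continuous_on {-r..0} (\<lambda>s. - (c * s))" by (intro continuous_intros)
  qed (use past_window in auto)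
  then show ?thesis unfolding past_input_def by (intro continuous_intros)
qed

text \<open>
  Both sides vanish at \<open>y = 0\<close> and have the same derivative by the choice of the past input.
\<close>
lemma memory_past_input:
  assumes v0: "C1_on {0..1} v0" "v0 0 = 0" and q: "with_history r (past_input v0) q"
    and y: "y \<in> {0..1}"
  shows "memory q 0 y = v0 y"
proof -
  have q_cont: "continuous_on {-r..} q" using q by (simp add: with_history_def)
  have "((\<lambda>y. memory q 0 y - v0 y) has_real_derivative 0) (at y within {0..1})"
    if y: "y \<in> {0..1}" for y
  proof -
    have "(v0 has_real_derivative deriv01 v0 y) (at y within {0..1})"
      using v0 y unfolding C1_on_def differentiable_on_def
      by (simp add: has_real_derivative_iff_has_vector_derivative vector_derivative_works)
    then have diff: "((\<lambda>y. memory q 0 y - v0 y) has_real_derivative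
        \<zeta> * r * exp (- \<zeta> * (r * y)) * q (0 - r * y) - deriv01 v0 y) (at y within {0..1})"
      by (intro DERIV_diff memory_has_derivative_space q_cont order_refl y)
    have "\<zeta> * r * exp (- \<zeta> * (r * y)) * q (0 - r * y) = deriv01 v0 y"
    proof -
      have "0 - r * y \<in> {-r..0}" using delay_window[OF y] by simp
      then have "q (0 - r * y) = past_input v0 (0 - r * y)"
        using q unfolding with_history_def by blast
      then show ?thesis
        using c_pos zeta_pos by (simp add: past_input_def r_eq exp_minus field_simps)
    qed
    then show ?thesis by (intro DERIV_cong[OF diff]) simp
  qed
  from has_field_derivative_zero_constant[OF _ this]
  obtain k where k: "\<And>y. y \<in> {0..1} \<Longrightarrow> memory q 0 y - v0 y = k" by auto
  from k[of 0] have "k = 0" using v0 by simp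
  with k[OF y] show ?thesis by simp
qed

end

locale reactor = transport_delay +
  fixes \<mu> K :: real and \<theta> u :: "real \<Rightarrow> real"
  assumes mu_pos: "0 < \<mu>" and theta_lipschitz: "K-lipschitz_on UNIV \<theta>"
    and u_cont: "continuous_on {0..} u"
begin

definition reactor_rhs :: "(real \<Rightarrow> real) \<Rightarrow> real \<Rightarrow> real" where
  "reactor_rhs q t = \<theta> (q t) - (\<mu> + 1) * q t + \<mu> * integral {0..1} (memory q t) + u t"

lemma continuous_on_reactor_rhs:
  assumes q: "continuous_on {-r..} q"
  shows "continuous_on {0..} (reactor_rhs q)"
proof -
  have q': "continuous_on {0..} q" using r_pos by (intro continuous_on_subset[OF q]) auto
  note \<theta> = lipschitz_on_continuous_on[OF theta_lipschitz]
  show ?thesis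
    unfolding reactor_rhs_def
    by (intro continuous_intros q' u_cont continuous_on_mean_memory[OF q]
        continuous_on_compose2[OF \<theta> q']) auto
qed

lemma reactor_solution_of_delay_equation:
  assumes v0: "C1_on {0..1} v0" "v0 0 = 0" and q: "with_history r (past_input v0) q"
    and ode: "\<And>t. 0 \<le> t \<Longrightarrow>
      (q has_real_derivative reactor_rhs q t) (at t within {0..})"
  shows "reactor_solution c \<mu> \<zeta> \<theta> u (q 0) v0 q (memory q)"
proof -
  have q_cont: "continuous_on {-r..} q" using q by (simp add: with_history_def)
  have deriv_q: "vector_derivative q (at t within {0..}) = reactor_rhs q t" if "0 \<le> t" for t
  proof (rule vector_derivative_within)
    have "at_right t \<le> at t within {0..}" using that by (intro at_le) auto
    then show "at t within {0..} \<noteq> bot"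
      using bot_unique[of "at_right t"] trivial_limit_at_right_real[of t] by auto
  qed (use ode[OF that] in \<open>simp add: has_real_derivative_iff_has_vector_derivative\<close>)
  have C1: "C1_on {0..} q"
    unfolding C1_on_def
  proof
    show "q differentiable_on {0..}"
      using ode unfolding differentiable_on_def real_differentiable_def by auto
    show "continuous_on {0..} (\<lambda>t. vector_derivative q (at t within {0..}))"
      using continuous_on_reactor_rhs[OF q_cont]
      by (rule continuous_on_eq) (simp add: deriv_q)
  qed
  define vt where "vt t y = \<zeta> * q t - \<zeta> * exp (- \<zeta> * (r * y)) * q (t - r * y) - \<zeta> * memory q t y" for t y
  define vz where "vz t y = \<zeta> * r * exp (- \<zeta> * (r * y)) * q (t - r * y)" for t y
  have cont: "continuous_on ({0..} \<times> {0..1}) (\<lambda>z. q (fst z))"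
    "continuous_on ({0..} \<times> {0..1}) (\<lambda>z. q (fst z - r * snd z))"
    "continuous_on ({0..} \<times> {0..1}) (\<lambda>z. memory q (fst z) (snd z))"
  proof -
    show "continuous_on ({0..} \<times> {0..1}) (\<lambda>z. q (fst z))"
      using r_pos by (intro continuous_on_compose2[OF q_cont continuous_on_fst]) auto
  qed (use continuous_on_delayed[OF q_cont] continuous_on_memory[OF q_cont] in
      \<open>simp_all add: case_prod_unfold\<close>)
  have pde: "vt t y + c * vz t y = - \<zeta> * memory q t y + \<zeta> * q t" for t y
    using c_pos by (simp add: vt_def vz_def r_eq)
  have strip: "\<exists>vt vz. (\<forall>t\<ge>0. \<forall>y\<in>{0..1}.
        ((\<lambda>s. memory q s y) has_real_derivative vt t y) (at t within {0..}) \<and>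
        (memory q t has_real_derivative vz t y) (at y within {0..1}) \<and>
        vt t y + c * vz t y = - \<zeta> * memory q t y + \<zeta> * q t) \<and>
      continuous_on ({0..} \<times> {0..1}) (\<lambda>(t, y). vt t y) \<and>
      continuous_on ({0..} \<times> {0..1}) (\<lambda>(t, y). vz t y)"
  proof (rule exI[of _ vt], rule exI[of _ vz], intro conjI allI impI ballI)
    fix t y :: real assume t: "0 \<le> t" and y: "y \<in> {0..1}"
    show "((\<lambda>s. memory q s y) has_real_derivative vt t y) (at t within {0..})"
      unfolding vt_def by (rule memory_has_derivative_time[OF q_cont t y])
    show "(memory q t has_real_derivative vz t y) (at y within {0..1})"
      unfolding vz_def by (rule memory_has_derivative_space[OF q_cont t y])
  next
    show "continuous_on ({0..} \<times> {0..1}) (\<lambda>(t, y). vt t y)"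
      unfolding vt_def case_prod_unfold by (intro continuous_intros cont)
    show "continuous_on ({0..} \<times> {0..1}) (\<lambda>(t, y). vz t y)"
      unfolding vz_def case_prod_unfold by (intro continuous_intros cont)
  qed (rule pde)
  have initial: "\<forall>y\<in>{0..1}. memory q 0 y = v0 y"
    using memory_past_input[OF v0 q] by blast
  have ode_all: "\<forall>t\<ge>0. (q has_real_derivative \<theta> (q t) - (\<mu> + 1) * q t
      + \<mu> * integral {0..1} (memory q t) + u t) (at t within {0..})"
    using ode by (simp add: reactor_rhs_def)
  have boundary: "\<forall>t\<ge>0. memory q t 0 = 0" by simp
  show ?thesis
    unfolding reactor_solution_def
    by (rule conjI[OF C1 conjI[OF ode_all conjI[OF strip conjI[OF boundary conjI[OF refl initial]]]]])
qed

text \<open>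
  The given \<open>v\<close> and the distributed delay of the extended \<open>x\<close> solve the same transport equation with the
  same data, so they coincide; the compatibility condition makes the extension continuous at \<open>0\<close>.
\<close>
lemma delay_equation_of_reactor_solution:
  assumes v0: "C1_on {0..1} v0" "v0 0 = 0" "c * deriv01 v0 0 = \<zeta> * x0"
    and sol: "reactor_solution c \<mu> \<zeta> \<theta> u x0 v0 x v"
  defines "q \<equiv> \<lambda>s. if s < 0 then past_input v0 s else x s"
  shows "with_history r (past_input v0) q"
    and "\<And>t y. 0 \<le> t \<Longrightarrow> y \<in> {0..1} \<Longrightarrow> v t y = memory q t y"
    and "\<And>t. 0 \<le> t \<Longrightarrow> (q has_real_derivative reactor_rhs q t) (at t within {0..})"
proof -
  have ode: "(x has_real_derivative \<theta> (x t) - (\<mu> + 1) * x t + \<mu> * integral {0..1} (v t) + u t)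
      (at t within {0..})" if "0 \<le> t" for t
    using sol that by (simp add: reactor_solution_def)
  have data: "\<And>t. 0 \<le> t \<Longrightarrow> v t 0 = 0" "x 0 = x0" "\<And>y. y \<in> {0..1} \<Longrightarrow> v 0 y = v0 y"
    using sol by (simp_all add: reactor_solution_def)
  from sol obtain vt vz where strip: "\<forall>t\<ge>0. \<forall>y\<in>{0..1}.
        ((\<lambda>s. v s y) has_real_derivative vt t y) (at t within {0..}) \<and>
        (v t has_real_derivative vz t y) (at y within {0..1}) \<and>
        vt t y + c * vz t y = - \<zeta> * v t y + \<zeta> * x t"
    and vz_cont: "continuous_on ({0..} \<times> {0..1}) (\<lambda>(t, y). vz t y)"
    unfolding reactor_solution_def by (elim conjE exE) (rule that)
  then have vt: "((\<lambda>s. v s y) has_real_derivative vt t y) (at t within {0..})"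
    and vz: "(v t has_real_derivative vz t y) (at y within {0..1})"
    and pde: "vt t y + c * vz t y = - \<zeta> * v t y + \<zeta> * x t"
    if "0 \<le> t" "y \<in> {0..1}" for t y
    using that by simp_all
  \<comment> \<open>This is the compatibility condition \<open>c v0'(0) = \<zeta> x0\<close>.\<close>
  have match: "past_input v0 0 = x 0"
    using v0(3) data(2) zeta_pos by (simp add: past_input_def field_simps)
  have "continuous_on {0..} x" using ode by (intro DERIV_continuous_on) auto
  then have "continuous_on {0..} q" by (rule continuous_on_eq) (simp add: q_def)
  moreover have "continuous_on {-r..0} q"
    using continuous_on_past_input[OF v0(1)] by (rule continuous_on_eq) (use match in \<open>auto simp: q_def\<close>)
  ultimately have "continuous_on ({-r..0} \<union> {0..}) q"
    by (intro continuous_on_closed_Un) auto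
  moreover have "{-r..0} \<union> {0..} = {-r..}" using r_pos by auto
  ultimately have q_cont: "continuous_on {-r..} q" by simp
  with match show q: "with_history r (past_input v0) q"
    by (auto simp: with_history_def q_def)
  show v: "v t y = memory q t y" if t: "0 \<le> t" and y: "y \<in> {0..1}" for t y
  proof -
    define mt where "mt t y = \<zeta> * q t - \<zeta> * exp (- \<zeta> * (r * y)) * q (t - r * y) - \<zeta> * memory q t y" for t y
    define mz where "mz t y = \<zeta> * r * exp (- \<zeta> * (r * y)) * q (t - r * y)" for t y
    have "v t y - memory q t y = 0"
    proof (rule transport_equation_zero_data[where d="\<lambda>t y. v t y - memory q t y"
          and dt="\<lambda>t y. vt t y - mt t y" and dy="\<lambda>t y. vz t y - mz t y" and c=c and \<zeta>=\<zeta>])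
      fix t y :: real assume t: "0 \<le> t" and y: "y \<in> {0..1}"
      show "((\<lambda>s. v s y - memory q s y) has_real_derivative vt t y - mt t y) (at t within {0..})"
        unfolding mt_def by (intro DERIV_diff vt memory_has_derivative_time q_cont t y)
      show "((\<lambda>y. v t y - memory q t y) has_real_derivative vz t y - mz t y) (at y within {0..1})"
        unfolding mz_def by (intro DERIV_diff vz memory_has_derivative_space q_cont t y)
      have "mt t y + c * mz t y = - \<zeta> * memory q t y + \<zeta> * x t"
        using c_pos t by (simp add: mt_def mz_def r_eq q_def)
      with pde[OF t y] show "vt t y - mt t y + c * (vz t y - mz t y) = - \<zeta> * (v t y - memory q t y)"
        by (simp add: algebra_simps)
    next
      have "continuous_on ({0..} \<times> {0..1}) (\<lambda>z. vz (fst z) (snd z))"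
        "continuous_on ({0..} \<times> {0..1}) (\<lambda>z. q (fst z - r * snd z))"
        using vz_cont continuous_on_delayed[OF q_cont] by (simp_all add: case_prod_unfold)
      then show "continuous_on ({0..} \<times> {0..1}) (\<lambda>(t, y). vz t y - mz t y)"
        unfolding mz_def case_prod_unfold by (intro continuous_intros)
    qed (use c_pos data memory_past_input[OF v0(1,2) q] t y in auto)
    then show ?thesis by simp
  qed
  show "(q has_real_derivative reactor_rhs q t) (at t within {0..})" if t: "0 \<le> t" for t
  proof -
    have "integral {0..1} (v t) = integral {0..1} (memory q t)"
      by (rule integral_cong) (rule v[OF t])
    then have "(x has_real_derivative reactor_rhs q t) (at t within {0..})"
      using ode[OF t] t by (simp add: reactor_rhs_def q_def)
    then show ?thesis
      by (rule has_field_derivative_transform_within[where d=1]) (use t in \<open>auto simp: q_def\<close>)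
  qed
qed

text \<open>
  The constant is the sum of the Lipschitz constants of \<open>\<theta>\<close>, of the linear term and of the mean of the
  distributed delay. It bounds both the Picard iteration and, in the error analysis, the mismatch
  between the reactor and its copy in the observer.
\<close>
lemma reactor_rhs_lipschitz:
  assumes q: "continuous_on {-r..} q" "continuous_on {-r..} q'" and t: "0 \<le> t"
    and B: "\<And>s. s \<in> {t - r..t} \<Longrightarrow> \<bar>q s - q' s\<bar> \<le> B"
  shows "\<bar>reactor_rhs q t - reactor_rhs q' t\<bar> \<le> (K + \<mu> + 1 + \<mu> * \<zeta> * r) * B"
proof -
  have now: "\<bar>q t - q' t\<bar> \<le> B" using B[of t] r_pos by simp
  have "\<bar>\<theta> (q t) - \<theta> (q' t)\<bar> \<le> K * \<bar>q t - q' t\<bar>"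
    using lipschitz_onD[OF theta_lipschitz] by (simp add: dist_real_def)
  also have "\<dots> \<le> K * B"
    using now lipschitz_on_nonneg[OF theta_lipschitz] by (intro mult_left_mono) auto
  finally have 1: "\<bar>\<theta> (q t) - \<theta> (q' t)\<bar> \<le> K * B" .
  have 2: "\<bar>(\<mu> + 1) * (q t - q' t)\<bar> \<le> (\<mu> + 1) * B"
    using now mu_pos by (simp add: abs_mult)
  have 3: "\<bar>\<mu> * (integral {0..1} (memory q t) - integral {0..1} (memory q' t))\<bar> \<le> \<mu> * (\<zeta> * r * B)"
    using mean_memory_diff_bound[OF q t B] mu_pos by (simp add: abs_mult)
  have "reactor_rhs q t - reactor_rhs q' t = (\<theta> (q t) - \<theta> (q' t)) - (\<mu> + 1) * (q t - q' t)
      + \<mu> * (integral {0..1} (memory q t) - integral {0..1} (memory q' t))"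
    by (simp add: reactor_rhs_def algebra_simps)
  also have "\<bar>\<dots>\<bar> \<le> K * B + (\<mu> + 1) * B + \<mu> * (\<zeta> * r * B)"
    using 1 2 3 by linarith
  finally show ?thesis by (simp add: algebra_simps)
qed

lemma reactor_delay_equation_volterra:
  assumes \<phi>: "continuous_on {-r..0} \<phi>"
  shows "causal_volterra r (K + \<mu> + 1 + \<mu> * \<zeta> * r) \<phi> reactor_rhs"
proof
  show "0 < K + \<mu> + 1 + \<mu> * \<zeta> * r"
    using lipschitz_on_nonneg[OF theta_lipschitz] mu_pos zeta_pos r_pos by (simp add: add_nonneg_pos)
  show "reactor_rhs X integrable_on {0..t}" if "with_history r \<phi> X" for X t
    using that unfolding with_history_def
    by (intro integrable_continuous_real continuous_on_subset[OF continuous_on_reactor_rhs]) auto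
  fix X Y s B
  assume X: "with_history r \<phi> X" and Y: "with_history r \<phi> Y" and s: "(0::real) \<le> s"
    and B: "\<And>p. p \<in> {0..s} \<Longrightarrow> norm (X p - Y p) \<le> B"
  have "0 \<le> B" using norm_ge_zero B[of s] s by (meson atLeastAtMost_iff order_refl order_trans)
  have "\<bar>X p - Y p\<bar> \<le> B" if "p \<in> {s - r..s}" for p
  proof (cases "0 \<le> p")
    case False
    then have "X p = Y p" using X Y that s by (simp add: with_history_def)
    then show ?thesis using \<open>0 \<le> B\<close> by simp
  qed (use B that in auto)
  then show "norm (reactor_rhs X s - reactor_rhs Y s) \<le> (K + \<mu> + 1 + \<mu> * \<zeta> * r) * B"
    using X Y s unfolding with_history_def real_norm_def by (intro reactor_rhs_lipschitz) auto
qed (use \<phi> r_pos in auto)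

lemma reactor_delay_equation_exists:
  assumes \<phi>: "continuous_on {-r..0} \<phi>"
  obtains q where "with_history r \<phi> q"
    and "\<And>t. 0 \<le> t \<Longrightarrow> (q has_real_derivative reactor_rhs q t) (at t within {0..})"
proof -
  interpret causal_volterra r "K + \<mu> + 1 + \<mu> * \<zeta> * r" \<phi> reactor_rhs
    by (rule reactor_delay_equation_volterra[OF \<phi>])
  obtain q where q: "with_history r \<phi> q" and eq: "\<And>t. 0 \<le> t \<Longrightarrow> q t = \<phi> 0 + integral {0..t} (reactor_rhs q)"
    by (rule solution_exists) (rule that)
  have "(q has_real_derivative reactor_rhs q t) (at t within {0..})" if t: "0 \<le> t" for t
  proof -
    have "((\<lambda>t. \<phi> 0 + integral {0..t} (reactor_rhs q)) has_real_derivative 0 + reactor_rhs q t) (at t within {0..})"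
      using q t unfolding with_history_def
      by (intro DERIV_add DERIV_const integral_has_derivative_halfline continuous_on_reactor_rhs) auto
    then show ?thesis
      by (rule has_field_derivative_transform_within[where d=1, THEN DERIV_cong])
        (use t eq in auto)
  qed
  with q show ?thesis by (rule that)
qed

lemma reactor_delay_equation_unique:
  assumes \<phi>: "continuous_on {-r..0} \<phi>"
    and X: "with_history r \<phi> X"
      "\<And>t. 0 \<le> t \<Longrightarrow> (X has_real_derivative reactor_rhs X t) (at t within {0..})"
    and Y: "with_history r \<phi> Y"
      "\<And>t. 0 \<le> t \<Longrightarrow> (Y has_real_derivative reactor_rhs Y t) (at t within {0..})"
    and t: "-r \<le> t"
  shows "X t = Y t"
proof -
  interpret causal_volterra r "K + \<mu> + 1 + \<mu> * \<zeta> * r" \<phi> reactor_rhs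
    by (rule reactor_delay_equation_volterra[OF \<phi>])
  have "Z t = \<phi> 0 + integral {0..t} (reactor_rhs Z)"
    if Z: "with_history r \<phi> Z" and ode: "\<And>t. 0 \<le> t \<Longrightarrow> (Z has_real_derivative reactor_rhs Z t) (at t within {0..})"
      and t: "0 \<le> t" for Z t
  proof -
    have "(reactor_rhs Z has_integral Z t - Z 0) {0..t}"
    proof (rule fundamental_theorem_of_calculus[OF t])
      fix s assume "s \<in> {0..t}"
      then show "(Z has_vector_derivative reactor_rhs Z s) (at s within {0..t})"
        using has_field_derivative_subset[OF ode[of s], of "{0..t}"]
        by (auto simp: has_real_derivative_iff_has_vector_derivative)
    qed
    moreover have "Z 0 = \<phi> 0" using Z r_pos by (simp add: with_history_def)
    ultimately show ?thesis by (simp add: integral_unique)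
  qed
  from solution_unique[OF X(1) this[OF X] Y(1) this[OF Y] t] show ?thesis by simp
qed

end

section \<open>Calculus in the plane and between sampling times\<close>

definition plane :: "real \<Rightarrow> real \<Rightarrow> real^2" where
  "plane a b = a *\<^sub>R axis 1 1 + b *\<^sub>R axis 2 1"

lemma plane_nth [simp]: "plane a b $ 1 = a" "plane a b $ 2 = b"
  by (simp_all add: plane_def axis_def)

lemma plane_eta: "plane (z $ 1) (z $ 2) = z"
  by (simp add: vec_eq_iff forall_2)

lemma norm_plane_diff: "norm (plane a b - plane a' b') \<le> \<bar>a - a'\<bar> + \<bar>b - b'\<bar>"
proof -
  have "plane a b - plane a' b' = (a - a') *\<^sub>R axis 1 1 + (b - b') *\<^sub>R axis 2 1"
    by (simp add: plane_def algebra_simps)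
  also have "norm \<dots> \<le> \<bar>a - a'\<bar> + \<bar>b - b'\<bar>"
    by (rule order_trans[OF norm_triangle_ineq]) simp
  finally show ?thesis .
qed

lemma continuous_on_plane [continuous_intros]:
  "continuous_on S f \<Longrightarrow> continuous_on S g \<Longrightarrow> continuous_on S (\<lambda>x. plane (f x) (g x))"
  unfolding plane_def by (intro continuous_intros)

lemma continuous_on_nth:
  fixes Z :: "real \<Rightarrow> real^2"
  shows "continuous_on S Z \<Longrightarrow> continuous_on S (\<lambda>s. Z s $ i)"
  by (intro continuous_intros)

lemma has_vector_derivative_planeI:
  assumes "((\<lambda>s. z s $ 1) has_real_derivative a) (at t within S)"
    and "((\<lambda>s. z s $ 2) has_real_derivative b) (at t within S)"
  shows "(z has_vector_derivative plane a b) (at t within S)"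
proof -
  have "((\<lambda>s. plane (z s $ 1) (z s $ 2)) has_vector_derivative plane a b) (at t within S)"
    unfolding plane_def
    using has_vector_derivative_scaleR[OF assms(1) has_vector_derivative_const, of "axis 1 1 :: real^2"]
      has_vector_derivative_scaleR[OF assms(2) has_vector_derivative_const, of "axis 2 1 :: real^2"]
    by (auto intro: has_vector_derivative_add)
  then show ?thesis by (simp add: plane_eta)
qed

lemma has_vector_derivative_nth:
  assumes "(z has_vector_derivative d) (at t within S)"
  shows "((\<lambda>s. z s $ i) has_real_derivative d $ i) (at t within S)"
  using bounded_linear.has_vector_derivative[OF bounded_linear_vec_nth assms]
  by (simp add: has_real_derivative_iff_has_vector_derivative)

locale sampling =
  fixes \<delta> :: real and \<tau> :: "nat \<Rightarrow> real"
  assumes sampling: "sampling_sequence \<delta> \<tau>"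
begin

lemma tau_0 [simp]: "\<tau> 0 = 0"
  using sampling by (simp add: sampling_sequence_def)

lemma tau_step: "\<tau> i < \<tau> (Suc i)" "\<tau> (Suc i) - \<tau> i \<le> \<delta>"
  using sampling by (simp_all add: sampling_sequence_def)

lemma strict_mono_tau: "strict_mono \<tau>"
  using tau_step by (simp add: strict_mono_Suc_iff)

lemma tau_nonneg: "0 \<le> \<tau> i"
  using strict_mono_less_eq[OF strict_mono_tau, of 0 i] by simp

lemma tau_exceeds:
  obtains i where "t < \<tau> i"
proof -
  have "\<forall>\<^sub>F i in sequentially. t < \<tau> i"
    using sampling by (simp add: sampling_sequence_def filterlim_at_top_dense)
  then show ?thesis using that by (auto simp: eventually_sequentially)
qed

text \<open>
  The index of the sampling interval containing a given nonnegative time.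
\<close>
definition current :: "real \<Rightarrow> nat" where
  "current t = (LEAST i. t < \<tau> (Suc i))"

lemma current_eq:
  assumes "t \<in> {\<tau> i..<\<tau> (Suc i)}"
  shows "current t = i"
  unfolding current_def
proof (rule Least_equality)
  fix j assume "t < \<tau> (Suc j)"
  then have "\<tau> i < \<tau> (Suc j)" using assms by simp
  then show "i \<le> j" by (simp add: strict_mono_less[OF strict_mono_tau])
qed (use assms in auto)

lemma current_interval:
  assumes "0 \<le> t"
  shows "t \<in> {\<tau> (current t)..<\<tau> (Suc (current t))}"
proof -
  obtain i where "t < \<tau> i" by (rule tau_exceeds)
  then have ex: "t < \<tau> (Suc i)" using tau_step(1)[of i] by simp
  have "t < \<tau> (Suc (current t))"
    unfolding current_def using ex by (rule LeastI)
  moreover have "\<tau> (current t) \<le> t"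
  proof (cases "current t")
    case (Suc j)
    then have "\<not> t < \<tau> (Suc j)" using not_less_Least[of j "\<lambda>i. t < \<tau> (Suc i)"] unfolding current_def by simp
    then show ?thesis using Suc by simp
  qed (use assms in auto)
  ultimately show ?thesis by simp
qed

lemma finite_samples: "finite (range \<tau> \<inter> {..T})"
proof -
  obtain n where n: "T < \<tau> n" by (rule tau_exceeds)
  have "range \<tau> \<inter> {..T} \<subseteq> \<tau> ` {..n}"
  proof
    fix s assume "s \<in> range \<tau> \<inter> {..T}"
    then obtain i where i: "s = \<tau> i" "\<tau> i \<le> T" by auto
    then have "\<tau> i < \<tau> n" using n by simp
    then show "s \<in> \<tau> ` {..n}" using i by (simp add: strict_mono_less[OF strict_mono_tau])
  qed
  then show ?thesis by (rule finite_subset) simp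
qed

lemma derivative_between_samples:
  assumes D: "\<And>i t. t \<in> {\<tau> i..<\<tau> (Suc i)} \<Longrightarrow> (f has_vector_derivative f' t) (at t within {\<tau> i..<\<tau> (Suc i)})"
    and t: "0 \<le> t" "t \<notin> range \<tau>"
  shows "(f has_vector_derivative f' t) (at t)"
proof -
  note i = current_interval[OF t(1)]
  have "\<tau> (current t) \<noteq> t" using t(2) rangeI[of \<tau> "current t"] by metis
  then have "t \<in> {\<tau> (current t)<..<\<tau> (Suc (current t))}" using i by auto
  then have "at t within {\<tau> (current t)<..<\<tau> (Suc (current t))} = at t"
    by (rule at_within_open) (rule open_greaterThanLessThan)
  moreover have "(f has_vector_derivative f' t) (at t within {\<tau> (current t)<..<\<tau> (Suc (current t))})"
    using D[OF i] by (rule has_vector_derivative_within_subset) auto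
  ultimately show ?thesis by (simp only:)
qed

text \<open>
  Only finitely many sampling times lie in a bounded interval, and a continuous function with a
  derivative off a finite set is the integral of that derivative.
\<close>
lemma piecewise_fundamental_theorem:
  fixes f :: "real \<Rightarrow> 'a::banach"
  assumes cont: "continuous_on {0..} f"
    and D: "\<And>i t. t \<in> {\<tau> i..<\<tau> (Suc i)} \<Longrightarrow> (f has_vector_derivative f' t) (at t within {\<tau> i..<\<tau> (Suc i)})"
    and t: "0 \<le> t"
  shows "(f' has_integral f t - f 0) {0..t}"
proof (rule fundamental_theorem_of_calculus_interior_strong[OF finite_samples[of t] t])
  show "(f has_vector_derivative f' s) (at s)" if "s \<in> {0<..<t} - range \<tau> \<inter> {..t}" for s
  proof (rule derivative_between_samples[of f f'])
    show "(f has_vector_derivative f' t) (at t within {\<tau> i..<\<tau> (Suc i)})"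
      if "t \<in> {\<tau> i..<\<tau> (Suc i)}" for i t
      using that by (rule D)
  qed (use that in auto)
  show "continuous_on {0..t} f" by (rule continuous_on_subset[OF cont]) auto
qed

text \<open>
  The functions \<open>g i\<close> continue \<open>f\<close> to the right end of each sampling interval, which also excludes
  unbounded behaviour there.
\<close>
lemma piecewise_continuous_integrable:
  fixes f :: "real \<Rightarrow> 'a::banach"
  assumes g: "\<And>i. continuous_on {\<tau> i..\<tau> (Suc i)} (g i)"
    and f: "\<And>i t. t \<in> {\<tau> i..<\<tau> (Suc i)} \<Longrightarrow> f t = g i t"
  shows "f integrable_on {0..t}"
proof -
  have "f integrable_on {0..\<tau> n}" for n
  proof (induction n)
    case 0
    show ?case using integrable_on_refl[of f "0::real"] by simp
  next
    case (Suc n)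
    have "f integrable_on {\<tau> n..\<tau> (Suc n)}"
    proof (rule integrable_spike_finite[of "{\<tau> (Suc n)}" _ _ "g n"])
      show "f t = g n t" if "t \<in> {\<tau> n..\<tau> (Suc n)} - {\<tau> (Suc n)}" for t
        using that by (intro f) auto
    qed (auto intro: integrable_continuous_real g)
    with Suc show ?case
      using tau_nonneg[of n] tau_step(1)[of n]
      by (intro Henstock_Kurzweil_Integration.integrable_combine[of 0 "\<tau> n" "\<tau> (Suc n)"]) auto
  qed
  moreover obtain n where "t < \<tau> n" by (rule tau_exceeds)
  ultimately show ?thesis
    using integrable_on_subinterval[of f "{0..\<tau> n}" 0 t] by auto
qed

lemma piecewise_integral_has_derivative:
  fixes f :: "real \<Rightarrow> 'a::banach"
  assumes g: "\<And>i. continuous_on {\<tau> i..\<tau> (Suc i)} (g i)"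
    and f: "\<And>i t. t \<in> {\<tau> i..<\<tau> (Suc i)} \<Longrightarrow> f t = g i t"
    and t: "t \<in> {\<tau> i..<\<tau> (Suc i)}"
  shows "((\<lambda>t. integral {0..t} f) has_vector_derivative f t) (at t within {\<tau> i..<\<tau> (Suc i)})"
proof -
  note int = piecewise_continuous_integrable[OF g f]
  have halfopen: "{\<tau> i..\<tau> (Suc i)} - {\<tau> (Suc i)} = {\<tau> i..<\<tau> (Suc i)}" by auto
  have "continuous_on {\<tau> i..<\<tau> (Suc i)} (g i)"
    by (rule continuous_on_subset[OF g]) auto
  then have "continuous_on {\<tau> i..<\<tau> (Suc i)} f"
    by (rule continuous_on_eq) (use f in auto)
  then have f_cont: "continuous (at t within {\<tau> i..<\<tau> (Suc i)}) f"
    using t by (simp add: continuous_on_eq_continuous_within)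
  have "((\<lambda>t. integral {\<tau> i..t} f) has_vector_derivative f t)
      (at t within {\<tau> i..\<tau> (Suc i)} - {\<tau> (Suc i)})"
  proof (rule integral_has_vector_derivative_continuous_at)
    show "f integrable_on {\<tau> i..\<tau> (Suc i)}"
      by (rule integrable_on_subinterval[OF int[of "\<tau> (Suc i)"]]) (use tau_nonneg in auto)
    show "continuous (at t within {\<tau> i..\<tau> (Suc i)} - {\<tau> (Suc i)}) f"
      using f_cont by (simp only: halfopen)
  qed (use t in auto)
  then have shifted: "((\<lambda>t. integral {0..\<tau> i} f + integral {\<tau> i..t} f) has_vector_derivative f t)
      (at t within {\<tau> i..<\<tau> (Suc i)})"
    unfolding halfopen using has_vector_derivative_add[OF has_vector_derivative_const] by fastforce
  have split: "integral {0..s} f = integral {0..\<tau> i} f + integral {\<tau> i..s} f"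
    if "s \<in> {\<tau> i..<\<tau> (Suc i)}" for s
    using that tau_nonneg[of i] Henstock_Kurzweil_Integration.integral_combine[OF _ _ int[of s], of "\<tau> i"]
    by simp
  show ?thesis
    by (rule has_vector_derivative_transform[OF t split shifted])
qed

end

section \<open>Well-posedness of the sampled observer\<close>

locale sampled_observer = reactor c r \<zeta> \<mu> K \<theta> u + sampling \<delta> \<tau>
  for c r \<zeta> \<mu> K :: real and \<theta> u :: "real \<Rightarrow> real" and \<delta> :: real and \<tau> :: "nat \<Rightarrow> real" +
  fixes k1 k2 :: real and \<xi> y :: "real \<Rightarrow> real"
  assumes k1_pos: "0 < k1" and k2_pos: "0 < k2"
begin

definition output_rhs :: "(real \<Rightarrow> real^2) \<Rightarrow> real \<Rightarrow> real" where
  "output_rhs Z t = \<zeta> * Z t $ 2 - \<zeta> * Z (t - r) $ 2 * exp (- \<zeta> * r) - \<zeta> * Z t $ 1"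

text \<open>
  On the sampling interval number \<open>i\<close> the signal \<open>w\<close> is this functional of the observer state, which
  is continuous up to the next sampling time; \<open>prediction\<close> glues these pieces together.
\<close>
definition prediction_from :: "nat \<Rightarrow> (real \<Rightarrow> real^2) \<Rightarrow> real \<Rightarrow> real" where
  "prediction_from i Z t = \<xi> (\<tau> i) + y (\<tau> i) + integral {\<tau> i..t} (output_rhs Z)"

definition prediction :: "(real \<Rightarrow> real^2) \<Rightarrow> real \<Rightarrow> real" where
  "prediction Z t = prediction_from (current t) Z t"

definition observer_rhs_with :: "real \<Rightarrow> (real \<Rightarrow> real^2) \<Rightarrow> real \<Rightarrow> real^2" where
  "observer_rhs_with w Z t = plane (output_rhs Z t - k1 * (Z t $ 1 - w))
     (reactor_rhs (\<lambda>s. Z s $ 2) t - k2 * (Z t $ 1 - w))"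

definition observer_rhs :: "(real \<Rightarrow> real^2) \<Rightarrow> real \<Rightarrow> real^2" where
  "observer_rhs Z t = observer_rhs_with (prediction Z t) Z t"

lemma observer_memory:
  "\<mu> * \<zeta> * integral {0..1} (\<lambda>l. integral {t - r * l..t} (\<lambda>s. q s * exp (- \<zeta> * (t - s))))
    = \<mu> * integral {0..1} (memory q t)"
  unfolding memory_def[abs_def] by (simp add: mult.commute)

lemma continuous_on_output_rhs:
  assumes Z: "continuous_on {-r..} Z"
  shows "continuous_on {0..} (output_rhs Z)"
proof -
  have 1: "continuous_on {0..} Z" using r_pos by (intro continuous_on_subset[OF Z]) auto
  have 2: "continuous_on {0..} (\<lambda>t. Z (t - r))"
    by (rule continuous_on_compose2[OF Z]) (auto intro!: continuous_intros)
  show ?thesis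
    unfolding output_rhs_def
    by (intro continuous_intros continuous_on_nth 1 2)
qed

lemma continuous_on_prediction_from:
  assumes Z: "continuous_on {-r..} Z"
  shows "continuous_on {\<tau> i..\<tau> (Suc i)} (prediction_from i Z)"
proof -
  have "continuous_on {\<tau> i..\<tau> (Suc i)} (output_rhs Z)"
    using tau_nonneg[of i] by (intro continuous_on_subset[OF continuous_on_output_rhs[OF Z]]) auto
  then have "continuous_on {\<tau> i..\<tau> (Suc i)} (\<lambda>t. integral {\<tau> i..t} (output_rhs Z))"
    by (intro indefinite_integral_continuous_1 integrable_continuous_real)
  then show ?thesis
    unfolding prediction_from_def by (intro continuous_intros)
qed

lemma prediction_eq: "t \<in> {\<tau> i..<\<tau> (Suc i)} \<Longrightarrow> prediction Z t = prediction_from i Z t"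
  by (simp only: prediction_def current_eq)

lemma prediction_sample: "prediction Z (\<tau> i) = \<xi> (\<tau> i) + y (\<tau> i)"
  using tau_step(1)[of i] prediction_eq[of "\<tau> i" i Z] by (simp add: prediction_from_def)

lemma continuous_on_observer_piece:
  assumes Z: "continuous_on {-r..} Z"
  shows "continuous_on {\<tau> i..\<tau> (Suc i)} (\<lambda>t. observer_rhs_with (prediction_from i Z t) Z t)"
proof -
  have sub: "{\<tau> i..\<tau> (Suc i)} \<subseteq> {0..}" using tau_nonneg[of i] by auto
  have Z0: "continuous_on {\<tau> i..\<tau> (Suc i)} Z"
    using sub r_pos by (intro continuous_on_subset[OF Z]) auto
  note 1 = continuous_on_subset[OF continuous_on_output_rhs[OF Z] sub]
  note 2 = continuous_on_subset[OF continuous_on_reactor_rhs[OF continuous_on_nth[OF Z]] sub]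
  show ?thesis
    unfolding observer_rhs_with_def
    by (intro continuous_on_plane continuous_on_diff continuous_on_mult continuous_on_const
        continuous_on_nth Z0 1 2 continuous_on_prediction_from[OF Z])
qed

lemma observer_rhs_piece:
  "t \<in> {\<tau> i..<\<tau> (Suc i)} \<Longrightarrow> observer_rhs Z t = observer_rhs_with (prediction_from i Z t) Z t"
  by (simp only: observer_rhs_def prediction_eq)

lemma output_rhs_lipschitz:
  assumes t: "0 \<le> t" and B: "\<And>s. s \<in> {-r..t} \<Longrightarrow> norm (Z s - Z' s) \<le> B"
  shows "\<bar>output_rhs Z t - output_rhs Z' t\<bar> \<le> 3 * \<zeta> * B"
proof -
  have comp: "\<bar>Z s $ i - Z' s $ i\<bar> \<le> B" if "s \<in> {-r..t}" for s i
    using B[OF that] component_le_norm_cart[of "Z s - Z' s" i] by simp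
  have "exp (- \<zeta> * r) \<le> 1" using zeta_pos r_pos by simp
  then have delayed: "\<bar>exp (- \<zeta> * r) * (Z (t - r) $ 2 - Z' (t - r) $ 2)\<bar> \<le> 1 * B"
    unfolding abs_mult using t r_pos by (intro mult_mono comp) auto
  have "output_rhs Z t - output_rhs Z' t = \<zeta> * ((Z t $ 2 - Z' t $ 2)
      - exp (- \<zeta> * r) * (Z (t - r) $ 2 - Z' (t - r) $ 2) - (Z t $ 1 - Z' t $ 1))"
    by (simp add: output_rhs_def algebra_simps)
  also have "\<bar>\<dots>\<bar> \<le> \<zeta> * (3 * B)"
    unfolding abs_mult using zeta_pos delayed comp[of t 1] comp[of t 2] t r_pos
    by (intro mult_mono) auto
  finally show ?thesis by simp
qed

text \<open>
  Since the sample does not depend on the observer state, predictions differ only by the integrals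
  since the last sampling time, over an interval of length at most \<open>\<delta>\<close>.
\<close>
lemma prediction_lipschitz:
  assumes Z: "continuous_on {-r..} Z" and Z': "continuous_on {-r..} Z'" and t: "0 \<le> t"
    and B: "\<And>s. s \<in> {-r..t} \<Longrightarrow> norm (Z s - Z' s) \<le> B"
  shows "\<bar>prediction Z t - prediction Z' t\<bar> \<le> 3 * \<zeta> * B * \<delta>"
proof -
  define i where "i = current t"
  have i: "t \<in> {\<tau> i..<\<tau> (Suc i)}" unfolding i_def by (rule current_interval[OF t])
  have "norm (Z t - Z' t) \<le> B" using t r_pos by (intro B) auto
  then have B0: "0 \<le> B" by (rule order_trans[OF norm_ge_zero])
  have sub: "{\<tau> i..t} \<subseteq> {0..}" using tau_nonneg[of i] by auto
  note cont = continuous_on_subset[OF continuous_on_output_rhs[OF Z] sub]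
    continuous_on_subset[OF continuous_on_output_rhs[OF Z'] sub]
  have "norm (integral {\<tau> i..t} (\<lambda>s. output_rhs Z s - output_rhs Z' s)) \<le> 3 * \<zeta> * B * (t - \<tau> i)"
  proof (rule integral_bound)
    show "continuous_on {\<tau> i..t} (\<lambda>s. output_rhs Z s - output_rhs Z' s)"
      by (intro continuous_on_diff cont)
    show "norm (output_rhs Z s - output_rhs Z' s) \<le> 3 * \<zeta> * B" if "s \<in> {\<tau> i..t}" for s
      unfolding real_norm_def using that sub by (intro output_rhs_lipschitz B) auto
  qed (use i in auto)
  also have "\<dots> \<le> 3 * \<zeta> * B * \<delta>"
    using i tau_step(2)[of i] zeta_pos B0 by (intro mult_left_mono) auto
  finally show ?thesis
    using cont
    by (simp add: prediction_eq[OF i] prediction_from_def integral_diff integrable_continuous_real)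
qed

lemma delta_pos: "0 < \<delta>"
  using tau_step[of 0] by simp

abbreviation (input) observer_lipschitz_constant :: real where
  "observer_lipschitz_constant \<equiv> 3 * \<zeta> + (K + \<mu> + 1 + \<mu> * \<zeta> * r) + (k1 + k2) * (1 + 3 * \<zeta> * \<delta>)"

lemma observer_rhs_lipschitz:
  assumes Z: "continuous_on {-r..} Z" and Z': "continuous_on {-r..} Z'" and t: "0 \<le> t"
    and B: "\<And>s. s \<in> {-r..t} \<Longrightarrow> norm (Z s - Z' s) \<le> B"
  shows "norm (observer_rhs Z t - observer_rhs Z' t) \<le> observer_lipschitz_constant * B"
proof -
  have comp: "\<bar>Z s $ i - Z' s $ i\<bar> \<le> B" if "s \<in> {-r..t}" for s i
    using B[OF that] component_le_norm_cart[of "Z s - Z' s" i] by simp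
  define e where "e = (Z t $ 1 - prediction Z t) - (Z' t $ 1 - prediction Z' t)"
  have "\<bar>e\<bar> \<le> B + 3 * \<zeta> * B * \<delta>"
    using prediction_lipschitz[OF assms] comp[of t 1] t r_pos unfolding e_def by auto
  then have inj: "\<bar>k * e\<bar> \<le> k * (B + 3 * \<zeta> * B * \<delta>)" if "0 < k" for k
    using that by (simp add: abs_mult)
  have out: "\<bar>output_rhs Z t - output_rhs Z' t\<bar> \<le> 3 * \<zeta> * B"
    by (rule output_rhs_lipschitz[OF t B])
  have rea: "\<bar>reactor_rhs (\<lambda>s. Z s $ 2) t - reactor_rhs (\<lambda>s. Z' s $ 2) t\<bar>
      \<le> (K + \<mu> + 1 + \<mu> * \<zeta> * r) * B"
    using t by (intro reactor_rhs_lipschitz continuous_on_nth Z Z' comp) auto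
  have "norm (observer_rhs Z t - observer_rhs Z' t)
      \<le> \<bar>(output_rhs Z t - output_rhs Z' t) - k1 * e\<bar>
        + \<bar>(reactor_rhs (\<lambda>s. Z s $ 2) t - reactor_rhs (\<lambda>s. Z' s $ 2) t) - k2 * e\<bar>"
    unfolding observer_rhs_def observer_rhs_with_def e_def
    by (rule order_trans[OF norm_plane_diff]) (simp add: algebra_simps)
  also have "\<dots> \<le> 3 * \<zeta> * B + k1 * (B + 3 * \<zeta> * B * \<delta>) + ((K + \<mu> + 1 + \<mu> * \<zeta> * r) * B
      + k2 * (B + 3 * \<zeta> * B * \<delta>))"
    using out rea inj[OF k1_pos] inj[OF k2_pos] by linarith
  also have "\<dots> = observer_lipschitz_constant * B" by (simp add: algebra_simps)
  finally show ?thesis .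
qed

lemma observer_volterra:
  assumes z0: "continuous_on {-r..0} z0"
  shows "causal_volterra r observer_lipschitz_constant z0 observer_rhs"
proof
  show "0 < observer_lipschitz_constant"
    using lipschitz_on_nonneg[OF theta_lipschitz] mu_pos zeta_pos r_pos k1_pos k2_pos delta_pos
    by (simp add: add_nonneg_pos add_pos_pos)
  show "observer_rhs Z integrable_on {0..t}" if "with_history r z0 Z" for Z t
    using that unfolding with_history_def
    by (intro piecewise_continuous_integrable[OF continuous_on_observer_piece observer_rhs_piece]) auto
  fix Z Z' s B
  assume Z: "with_history r z0 Z" and Z': "with_history r z0 Z'" and s: "(0::real) \<le> s"
    and B: "\<And>p. p \<in> {0..s} \<Longrightarrow> norm (Z p - Z' p) \<le> B"
  have "0 \<le> B" using norm_ge_zero B[of s] s by (meson atLeastAtMost_iff order_refl order_trans)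
  have "norm (Z p - Z' p) \<le> B" if "p \<in> {-r..s}" for p
  proof (cases "0 \<le> p")
    case False
    then have "Z p = Z' p" using Z Z' that by (simp add: with_history_def)
    then show ?thesis using \<open>0 \<le> B\<close> by simp
  qed (use B that in auto)
  then show "norm (observer_rhs Z s - observer_rhs Z' s) \<le> observer_lipschitz_constant * B"
    using Z Z' s unfolding with_history_def by (intro observer_rhs_lipschitz) auto
qed (use z0 r_pos in auto)

lemma observer_exists:
  assumes z0: "continuous_on {-r..0} z0"
  obtains z w where "observer_solution r \<mu> \<zeta> \<theta> k1 k2 \<tau> u \<xi> y z0 z w"
proof -
  interpret causal_volterra r observer_lipschitz_constant z0 observer_rhs
    by (rule observer_volterra[OF z0])
  obtain z where z: "with_history r z0 z"
    and eq: "\<And>t. 0 \<le> t \<Longrightarrow> z t = z0 0 + integral {0..t} (observer_rhs z)"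
    by (rule solution_exists) (rule that)
  have cont: "continuous_on {-r..} z" using z by (simp add: with_history_def)
  have dz: "(z has_vector_derivative observer_rhs z t) (at t within {\<tau> i..<\<tau> (Suc i)})"
    if t: "t \<in> {\<tau> i..<\<tau> (Suc i)}" for i t
  proof -
    have "((\<lambda>t. z0 0 + integral {0..t} (observer_rhs z)) has_vector_derivative 0 + observer_rhs z t)
        (at t within {\<tau> i..<\<tau> (Suc i)})"
      by (intro has_vector_derivative_add has_vector_derivative_const
          piecewise_integral_has_derivative[OF continuous_on_observer_piece[OF cont] observer_rhs_piece t])
    then have shifted: "((\<lambda>t. z0 0 + integral {0..t} (observer_rhs z)) has_vector_derivative observer_rhs z t)
        (at t within {\<tau> i..<\<tau> (Suc i)})"
      by (simp only: add_0_left)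
    have volterra: "z s = z0 0 + integral {0..s} (observer_rhs z)" if "s \<in> {\<tau> i..<\<tau> (Suc i)}" for s
      using that tau_nonneg[of i] by (intro eq) auto
    show ?thesis
      by (rule has_vector_derivative_transform[OF t volterra shifted])
  qed
  have dw: "(prediction z has_real_derivative output_rhs z t) (at t within {\<tau> i..<\<tau> (Suc i)})"
    if t: "t \<in> {\<tau> i..<\<tau> (Suc i)}" for i t
  proof -
    have "continuous_on {\<tau> i..} (output_rhs z)"
      using tau_nonneg[of i] by (intro continuous_on_subset[OF continuous_on_output_rhs[OF cont]]) auto
    from integral_has_derivative_halfline[OF this, of t]
    have "((\<lambda>t. integral {\<tau> i..t} (output_rhs z)) has_real_derivative output_rhs z t)
        (at t within {\<tau> i..<\<tau> (Suc i)})"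
      using t by (auto elim: has_field_derivative_subset)
    then have "(prediction_from i z has_real_derivative 0 + output_rhs z t) (at t within {\<tau> i..<\<tau> (Suc i)})"
      unfolding prediction_from_def by (intro DERIV_add DERIV_const)
    then show ?thesis
      by (rule has_field_derivative_transform_within[where d=1, THEN DERIV_cong])
        (use t in \<open>simp_all add: prediction_eq[of _ i]\<close>)
  qed
  have "observer_solution r \<mu> \<zeta> \<theta> k1 k2 \<tau> u \<xi> y z0 z (prediction z)"
    unfolding observer_solution_def
  proof (intro conjI allI ballI)
    fix i t assume t: "t \<in> {\<tau> i..<\<tau> (Suc i)}"
    note d = has_vector_derivative_nth[OF dz[OF t]]
    show "((\<lambda>s. z s $ 1) has_real_derivative
        \<zeta> * z t $ 2 - \<zeta> * z (t - r) $ 2 * exp (- \<zeta> * r) - \<zeta> * z t $ 1 - k1 * (z t $ 1 - prediction z t))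
        (at t within {\<tau> i..<\<tau> (Suc i)})"
      using d[of 1] by (simp add: observer_rhs_def observer_rhs_with_def output_rhs_def)
    show "((\<lambda>s. z s $ 2) has_real_derivative
        \<theta> (z t $ 2) - (\<mu> + 1) * z t $ 2
        + \<mu> * \<zeta> * integral {0..1} (\<lambda>l. integral {t - r * l..t} (\<lambda>s. z s $ 2 * exp (- \<zeta> * (t - s))))
        + u t - k2 * (z t $ 1 - prediction z t)) (at t within {\<tau> i..<\<tau> (Suc i)})"
      unfolding observer_memory
      using d[of 2] by (simp add: observer_rhs_def observer_rhs_with_def reactor_rhs_def)
    show "(prediction z has_real_derivative
        \<zeta> * z t $ 2 - \<zeta> * z (t - r) $ 2 * exp (- \<zeta> * r) - \<zeta> * z t $ 1) (at t within {\<tau> i..<\<tau> (Suc i)})"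
      using dw[OF t] by (simp only: output_rhs_def)
  qed (use z in \<open>auto simp: with_history_def prediction_sample\<close>)
  then show ?thesis by (rule that)
qed

text \<open>
  Eliminates \<open>w\<close>: its differential equation between samples does not contain \<open>w\<close> itself.
\<close>
lemma observer_solution_prediction:
  assumes sol: "observer_solution r \<mu> \<zeta> \<theta> k1 k2 \<tau> u \<xi> y z0 z w" and t: "0 \<le> t"
  shows "w t = prediction z t"
proof -
  define i where "i = current t"
  have i: "t \<in> {\<tau> i..<\<tau> (Suc i)}" unfolding i_def by (rule current_interval[OF t])
  have dw: "(w has_real_derivative output_rhs z s) (at s within {\<tau> i..<\<tau> (Suc i)})"
    if "s \<in> {\<tau> i..<\<tau> (Suc i)}" for s
    using sol that unfolding observer_solution_def output_rhs_def by blast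
  have "(output_rhs z has_integral w t - w (\<tau> i)) {\<tau> i..t}"
  proof (rule fundamental_theorem_of_calculus)
    fix s assume s: "s \<in> {\<tau> i..t}"
    show "(w has_vector_derivative output_rhs z s) (at s within {\<tau> i..t})"
      unfolding has_real_derivative_iff_has_vector_derivative[symmetric]
      by (rule has_field_derivative_subset[OF dw]) (use s i in auto)
  qed (use i in auto)
  moreover have "w (\<tau> i) = \<xi> (\<tau> i) + y (\<tau> i)"
    using sol by (simp add: observer_solution_def)
  ultimately show ?thesis
    by (simp add: prediction_eq[OF i] prediction_from_def integral_unique)
qed

lemma observer_solution_derivative:
  assumes sol: "observer_solution r \<mu> \<zeta> \<theta> k1 k2 \<tau> u \<xi> y z0 z w" and t: "t \<in> {\<tau> i..<\<tau> (Suc i)}"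
  shows "(z has_vector_derivative observer_rhs z t) (at t within {\<tau> i..<\<tau> (Suc i)})"
proof -
  have "((\<lambda>s. z s $ 1) has_real_derivative
        \<zeta> * z t $ 2 - \<zeta> * z (t - r) $ 2 * exp (- \<zeta> * r) - \<zeta> * z t $ 1 - k1 * (z t $ 1 - w t))
        (at t within {\<tau> i..<\<tau> (Suc i)})"
    "((\<lambda>s. z s $ 2) has_real_derivative
        \<theta> (z t $ 2) - (\<mu> + 1) * z t $ 2
        + \<mu> * \<zeta> * integral {0..1} (\<lambda>l. integral {t - r * l..t} (\<lambda>s. z s $ 2 * exp (- \<zeta> * (t - s))))
        + u t - k2 * (z t $ 1 - w t)) (at t within {\<tau> i..<\<tau> (Suc i)})"
    using sol t unfolding observer_solution_def by blast+
  from has_vector_derivative_planeI[OF this] show ?thesis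
    unfolding observer_memory
    using observer_solution_prediction[OF sol, of t] t tau_nonneg[of i]
    by (simp add: observer_rhs_def observer_rhs_with_def output_rhs_def reactor_rhs_def)
qed

lemma observer_unique:
  assumes z0: "continuous_on {-r..0} z0"
    and sol: "observer_solution r \<mu> \<zeta> \<theta> k1 k2 \<tau> u \<xi> y z0 z w"
    and sol': "observer_solution r \<mu> \<zeta> \<theta> k1 k2 \<tau> u \<xi> y z0 z' w'"
  shows "-r \<le> t \<Longrightarrow> z t = z' t" and "0 \<le> t \<Longrightarrow> w t = w' t"
proof -
  interpret causal_volterra r observer_lipschitz_constant z0 observer_rhs
    by (rule observer_volterra[OF z0])
  have hist: "with_history r z0 z" if "observer_solution r \<mu> \<zeta> \<theta> k1 k2 \<tau> u \<xi> y z0 z w" for z w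
    using that by (simp add: observer_solution_def with_history_def)
  have eq: "z t = z0 0 + integral {0..t} (observer_rhs z)"
    if sol: "observer_solution r \<mu> \<zeta> \<theta> k1 k2 \<tau> u \<xi> y z0 z w" and t: "0 \<le> t" for z w t
  proof -
    have "continuous_on {0..} z"
      using hist[OF sol] r_pos unfolding with_history_def by (auto elim: continuous_on_subset)
    from piecewise_fundamental_theorem[OF this observer_solution_derivative[OF sol] t]
    have "z t - z 0 = integral {0..t} (observer_rhs z)" by (simp add: integral_unique)
    moreover have "z 0 = z0 0" using hist[OF sol] r_pos by (simp add: with_history_def)
    ultimately show ?thesis by (simp add: algebra_simps)
  qed
  show z: "z t = z' t" if "-r \<le> t" for t
    by (rule solution_unique[OF hist[OF sol] eq[OF sol] hist[OF sol'] eq[OF sol'] that])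
  show "w t = w' t" if t: "0 \<le> t" for t
  proof -
    define i where "i = current t"
    have i: "t \<in> {\<tau> i..<\<tau> (Suc i)}" unfolding i_def by (rule current_interval[OF t])
    have "integral {\<tau> i..t} (output_rhs z) = integral {\<tau> i..t} (output_rhs z')"
      using tau_nonneg[of i] r_pos by (intro integral_cong) (simp add: output_rhs_def z)
    then show ?thesis
      using observer_solution_prediction[OF sol t] observer_solution_prediction[OF sol' t]
      by (simp add: prediction_eq[OF i] prediction_from_def)
  qed
qed

end

section \<open>Exponential decay of the observer error\<close>

text \<open>
  Variation of constants: \<open>exp (a t) q t\<close> grows with speed at most \<open>B exp ((a - \<omega>) t)\<close>. The forcing is
  divided by \<open>a - \<omega>\<close>, so strong damping makes any fixed forcing negligible.
\<close>
lemma (in sampling) damped_equation_bound: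
  fixes q f :: "real \<Rightarrow> real"
  assumes cont: "continuous_on {0..} q"
    and D: "\<And>i t. t \<in> {\<tau> i..<\<tau> (Suc i)} \<Longrightarrow>
      (q has_real_derivative f t - a * q t) (at t within {\<tau> i..<\<tau> (Suc i)})"
    and bound: "\<And>t. t \<in> {0..T} \<Longrightarrow> \<bar>f t\<bar> \<le> B * exp (- \<omega> * t)"
    and a: "0 < \<omega>" "\<omega> < a" and t: "t \<in> {0..T}"
  shows "\<bar>q t\<bar> \<le> (\<bar>q 0\<bar> + B / (a - \<omega>)) * exp (- \<omega> * t)"
proof -
  have t0: "0 \<le> t" using t by simp
  have B0: "0 \<le> B" using bound[of 0] t by simp
  have "((\<lambda>s. exp (a * s) * q s) has_vector_derivative exp (a * s) * f s) (at s within {\<tau> i..<\<tau> (Suc i)})"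
    if s: "s \<in> {\<tau> i..<\<tau> (Suc i)}" for i s
  proof -
    have "((\<lambda>s. exp (a * s) * q s) has_real_derivative exp (a * s) * a * q s + exp (a * s) * (f s - a * q s))
        (at s within {\<tau> i..<\<tau> (Suc i)})"
      by (rule derivative_eq_intros D[OF s] refl | simp)+
    then show ?thesis
      by (simp add: has_real_derivative_iff_has_vector_derivative algebra_simps)
  qed
  from piecewise_fundamental_theorem[OF _ this t0]
  have int: "((\<lambda>s. exp (a * s) * f s) has_integral exp (a * t) * q t - q 0) {0..t}"
    using cont by (simp add: continuous_on_mult continuous_on_exp)
  have exp_int: "((\<lambda>s. B * exp ((a - \<omega>) * s)) has_integral
      B / (a - \<omega>) * exp ((a - \<omega>) * t) - B / (a - \<omega>) * exp ((a - \<omega>) * 0)) {0..t}"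
    using a t0
    by (intro fundamental_theorem_of_calculus)
      (auto simp: has_real_derivative_iff_has_vector_derivative[symmetric]
        intro!: derivative_eq_intros)
  have "norm (integral {0..t} (\<lambda>s. exp (a * s) * f s)) \<le> integral {0..t} (\<lambda>s. B * exp ((a - \<omega>) * s))"
  proof (rule integral_norm_bound_integral)
    fix s assume s: "s \<in> {0..t}"
    have "\<bar>exp (a * s) * f s\<bar> \<le> exp (a * s) * (B * exp (- \<omega> * s))"
      using bound[of s] s t by (simp add: abs_mult)
    also have "\<dots> = B * exp ((a - \<omega>) * s)" by (simp add: algebra_simps flip: exp_add)
    finally show "norm (exp (a * s) * f s) \<le> B * exp ((a - \<omega>) * s)" by simp
  qed (use int exp_int in blast)+
  also have "integral {0..t} (\<lambda>s. B * exp ((a - \<omega>) * s))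
      = B / (a - \<omega>) * exp ((a - \<omega>) * t) - B / (a - \<omega>)"
    using integral_unique[OF exp_int] by (simp only: mult_zero_right exp_zero mult_1_right)
  also have "\<dots> \<le> B / (a - \<omega>) * exp ((a - \<omega>) * t)"
    using a B0 by simp
  finally have "\<bar>exp (a * t) * q t - q 0\<bar> \<le> B / (a - \<omega>) * exp ((a - \<omega>) * t)"
    using integral_unique[OF int] by simp
  moreover have "\<bar>q 0\<bar> * 1 \<le> \<bar>q 0\<bar> * exp ((a - \<omega>) * t)"
    using a t0 by (intro mult_left_mono) auto
  ultimately have "\<bar>exp (a * t) * q t\<bar> \<le> (\<bar>q 0\<bar> + B / (a - \<omega>)) * exp ((a - \<omega>) * t)"
    by (simp add: distrib_right)
  then have "exp (- a * t) * (exp (a * t) * \<bar>q t\<bar>)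
      \<le> exp (- a * t) * ((\<bar>q 0\<bar> + B / (a - \<omega>)) * exp ((a - \<omega>) * t))"
    by (simp add: abs_mult)
  moreover have "exp (- a * t) * (exp (a * t) * \<bar>q t\<bar>) = \<bar>q t\<bar>"
    by (simp add: exp_minus)
  moreover have "exp (- a * t) * ((\<bar>q 0\<bar> + B / (a - \<omega>)) * exp ((a - \<omega>) * t))
      = (\<bar>q 0\<bar> + B / (a - \<omega>)) * exp (- \<omega> * t)"
  proof -
    have "exp (- a * t) * exp ((a - \<omega>) * t) = exp (- \<omega> * t)"
      by (simp add: algebra_simps flip: exp_add)
    then show ?thesis by (metis mult.commute mult.left_commute)
  qed
  ultimately show ?thesis by (simp only:)
qed

text \<open>
  Without the terms in \<open>H\<close>, inserting the first inequality into the second leaves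
  \<open>(1 - \<kappa>) / 2 * S2\<close> on the left. The terms in \<open>H\<close> feed \<open>S2\<close> and \<open>Sp\<close> back with a factor of order
  \<open>L \<epsilon>\<close>; the last assumption is what keeps half of the left-hand side.
\<close>
lemma small_gain:
  fixes N X S2 Sp H :: real
  assumes \<kappa>: "0 < \<kappa>" "\<kappa> < 1" and nonneg: "0 \<le> N" "0 \<le> S2" "0 \<le> H" "0 < L" "0 \<le> \<epsilon>"
    and first: "Sp \<le> N + \<kappa> * S2 + 2 * (L * H)"
    and second: "(1 + \<kappa>) / 2 * S2 \<le> N + Sp + L * H"
    and held: "H \<le> G * X + \<epsilon> * (S2 + Sp)"
    and small: "48 * L * \<epsilon> \<le> 1 - \<kappa>"
  shows "S2 \<le> (12 * N + 24 * L * G * X) / (1 - \<kappa>)"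
proof -
  have "\<kappa> * S2 \<le> 1 * S2" using \<kappa> nonneg by (intro mult_right_mono) auto
  then have "\<epsilon> * (S2 + Sp) \<le> \<epsilon> * (N + 2 * S2 + 2 * (L * H))"
    using first nonneg by (intro mult_left_mono) auto
  moreover have "L * \<epsilon> * H \<le> 1 / 48 * H" using small \<kappa> nonneg by (intro mult_right_mono) auto
  ultimately have "H \<le> G * X + \<epsilon> * N + 2 * (\<epsilon> * S2) + 1 / 24 * H"
    using held by (simp add: algebra_simps)
  then have "23 / 24 * H \<le> G * X + \<epsilon> * N + 2 * (\<epsilon> * S2)" by simp
  then have H: "H \<le> 2 * (G * X + \<epsilon> * N + 2 * (\<epsilon> * S2))" using nonneg(3) by argo
  have "L * H \<le> L * (2 * (G * X + \<epsilon> * N + 2 * (\<epsilon> * S2)))"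
    using H nonneg by (intro mult_left_mono) auto
  then have LH: "L * H \<le> 2 * (L * G * X) + 2 * (L * \<epsilon> * N) + 4 * (L * \<epsilon> * S2)"
    by (simp add: algebra_simps)
  have "L * \<epsilon> * N \<le> 1 / 48 * N" using small \<kappa> nonneg by (intro mult_right_mono) auto
  moreover have "L * \<epsilon> * S2 \<le> (1 - \<kappa>) / 48 * S2" using small nonneg by (intro mult_right_mono) auto
  moreover have "(1 + \<kappa>) / 2 * S2 = \<kappa> * S2 + 24 * ((1 - \<kappa>) / 48 * S2)" by (simp add: field_simps)
  ultimately have "12 * ((1 - \<kappa>) / 48 * S2) \<le> 3 * N + 6 * (L * G * X)"
    using first second LH nonneg by linarith
  then show ?thesis using \<kappa> by (simp add: field_simps)
qed

text \<open>
  The supremum of \<open>exp (\<omega> t) \<bar>f t\<bar>\<close> is attained. Evaluating a bound at a maximiser turns pointwise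
  estimates into inequalities between suprema, as needed for the small-gain argument.
\<close>
lemma weighted_maximum:
  fixes f :: "real \<Rightarrow> real"
  assumes "continuous_on {a..T} f" "a \<le> T"
  obtains s where "s \<in> {a..T}" "\<And>t. t \<in> {a..T} \<Longrightarrow> \<bar>f t\<bar> \<le> \<bar>f s\<bar> * exp (\<omega> * s) * exp (- \<omega> * t)"
proof -
  have "continuous_on {a..T} (\<lambda>t. \<bar>f t\<bar> * exp (\<omega> * t))"
    by (intro continuous_intros assms)
  from continuous_attains_sup[OF _ _ this] obtain s where s: "s \<in> {a..T}"
    and max: "\<And>t. t \<in> {a..T} \<Longrightarrow> \<bar>f t\<bar> * exp (\<omega> * t) \<le> \<bar>f s\<bar> * exp (\<omega> * s)"
    using assms(2) by auto
  have "\<bar>f t\<bar> \<le> \<bar>f s\<bar> * exp (\<omega> * s) * exp (- \<omega> * t)" if "t \<in> {a..T}" for t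
  proof -
    have "\<bar>f t\<bar> = \<bar>f t\<bar> * exp (\<omega> * t) * exp (- \<omega> * t)" by (simp add: exp_minus)
    also have "\<dots> \<le> \<bar>f s\<bar> * exp (\<omega> * s) * exp (- \<omega> * t)"
      by (intro mult_right_mono max that) auto
    finally show ?thesis .
  qed
  with s show ?thesis by (rule that)
qed

text \<open>
  A solution of the observer driven by a solution of the reactor, with the tuned gains. The
  assumptions on the constants say, in this order: the damping of \<open>p\<close> is at least twice the decay
  rate; the gain from \<open>e2\<close> to \<open>p\<close> is at most \<open>\<kappa>\<close>; the gain from \<open>p\<close> to \<open>e2\<close> is at most
  \<open>2 / (1 + \<kappa>)\<close>, so that the loop gain stays below one; the drift of the prediction over one
  sampling period is dominated by the remaining margin.
\<close>
locale observer_error = sampled_observer c r \<zeta> \<mu> K \<theta> u \<delta> \<tau> k1 k2 \<xi> y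
  for c r \<zeta> \<mu> K :: real and \<theta> u :: "real \<Rightarrow> real" and \<delta> :: real and \<tau> :: "nat \<Rightarrow> real"
    and k1 k2 :: real and \<xi> y :: "real \<Rightarrow> real" +
  fixes lam b \<omega> \<kappa> :: real and x :: "real \<Rightarrow> real" and z0 z :: "real \<Rightarrow> real^2" and w :: "real \<Rightarrow> real"
  assumes k1_eq: "k1 = lam * \<zeta> + b - \<zeta>" and k2_eq: "k2 = b * lam"
    and omega_pos: "0 < \<omega>" and kappa: "0 < \<kappa>" "\<kappa> < 1" and lam_ge_1: "1 \<le> lam" and b_pos: "0 < b"
    and slow: "2 * \<omega> \<le> lam * \<zeta>"
    and first_gain: "(K + \<mu> + 1 + \<mu> * \<zeta> * r) * exp (\<omega> * r) + lam * \<zeta> * (exp (- \<zeta> * r) * exp (\<omega> * r))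
      \<le> \<kappa> * (lam * \<zeta> - \<omega>)"
    and second_gain: "b * ((1 + \<kappa>) / 2) \<le> b - \<omega> - (K + \<mu> + 1 + \<mu> * \<zeta> * r) * exp (\<omega> * r)"
    and fast_sampling: "\<delta> \<le> 1"
      "48 * lam * exp \<omega> * \<zeta> * (1 + exp (\<omega> * r) + 1 / lam) * \<delta> \<le> 1 - \<kappa>"
    and x_cont: "continuous_on {-r..} x"
    and x_ode: "\<And>t. 0 \<le> t \<Longrightarrow> (x has_real_derivative reactor_rhs x t) (at t within {0..})"
    and y_eq: "\<And>t. 0 \<le> t \<Longrightarrow> y t = memory x t 1"
    and observer: "observer_solution r \<mu> \<zeta> \<theta> k1 k2 \<tau> u \<xi> y z0 z w"
begin

definition e1 :: "real \<Rightarrow> real" where "e1 t = z t $ 1 - memory x t 1"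
definition e2 :: "real \<Rightarrow> real" where "e2 t = z t $ 2 - x t"

text \<open>
  The gains are chosen such that all terms in \<open>e1 t\<close> of the derivative of \<open>p\<close> merge into
  \<open>- lam * \<zeta> * p t\<close>, which leaves a damped scalar equation.
\<close>
definition p :: "real \<Rightarrow> real" where "p t = e2 t - lam * e1 t"

text \<open>
  The error of the signal that replaces the outlet value in the injection terms.
\<close>
definition \<eta> :: "real \<Rightarrow> real" where "\<eta> t = w t - memory x t 1"

definition mismatch :: "real \<Rightarrow> real" where
  "mismatch t = reactor_rhs (\<lambda>s. z s $ 2) t - reactor_rhs x t"

abbreviation (input) output_error :: "real \<Rightarrow> real" where
  "output_error t \<equiv> \<zeta> * e2 t - \<zeta> * exp (- \<zeta> * r) * e2 (t - r) - \<zeta> * e1 t"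

lemma lam_pos: "0 < lam"
  using lam_ge_1 by simp

lemma z_cont: "continuous_on {-r..} z"
  using observer by (simp add: observer_solution_def)

lemma e2_cont: "continuous_on {-r..} e2"
  unfolding e2_def by (intro continuous_intros continuous_on_nth z_cont x_cont)

lemma nonneg_subset: "{0..} \<subseteq> {-r..}"
  using r_pos by auto

lemma output_derivative:
  assumes "t \<in> {\<tau> i..<\<tau> (Suc i)}"
  shows "((\<lambda>t. memory x t 1) has_real_derivative
    \<zeta> * x t - \<zeta> * exp (- \<zeta> * r) * x (t - r) - \<zeta> * memory x t 1) (at t within {\<tau> i..<\<tau> (Suc i)})"
proof -
  have t: "0 \<le> t" and sub: "{\<tau> i..<\<tau> (Suc i)} \<subseteq> {0..}" using assms tau_nonneg[of i] by auto
  show ?thesis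
    using has_field_derivative_subset[OF memory_has_derivative_time[OF x_cont t, of 1] sub] by simp
qed

lemma p_cont: "continuous_on {0..} p"
proof -
  have "continuous_on {0..} (\<lambda>t. memory x t 1)"
    by (rule DERIV_continuous_on) (auto intro: memory_has_derivative_time[OF x_cont])
  then show ?thesis
    unfolding p_def e1_def
    by (intro continuous_intros continuous_on_nth continuous_on_subset[OF z_cont nonneg_subset]
        continuous_on_subset[OF e2_cont nonneg_subset])
qed

lemma state_derivatives:
  assumes t: "t \<in> {\<tau> i..<\<tau> (Suc i)}"
  shows "((\<lambda>t. z t $ 1) has_real_derivative output_rhs z t - k1 * (z t $ 1 - w t)) (at t within {\<tau> i..<\<tau> (Suc i)})"
    and "((\<lambda>t. z t $ 2) has_real_derivative reactor_rhs (\<lambda>s. z s $ 2) t - k2 * (z t $ 1 - w t)) (at t within {\<tau> i..<\<tau> (Suc i)})"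
proof -
  have w: "w t = prediction z t"
    using t tau_nonneg[of i] by (intro observer_solution_prediction[OF observer]) auto
  note d = has_vector_derivative_nth[OF observer_solution_derivative[OF observer t]]
  show "((\<lambda>t. z t $ 1) has_real_derivative output_rhs z t - k1 * (z t $ 1 - w t)) (at t within {\<tau> i..<\<tau> (Suc i)})"
    using d[of 1] by (simp add: observer_rhs_def observer_rhs_with_def w)
  show "((\<lambda>t. z t $ 2) has_real_derivative reactor_rhs (\<lambda>s. z s $ 2) t - k2 * (z t $ 1 - w t)) (at t within {\<tau> i..<\<tau> (Suc i)})"
    using d[of 2] by (simp add: observer_rhs_def observer_rhs_with_def w)
qed

lemma e1_derivative:
  assumes t: "t \<in> {\<tau> i..<\<tau> (Suc i)}"
  shows "(e1 has_real_derivative output_error t - k1 * (e1 t - \<eta> t)) (at t within {\<tau> i..<\<tau> (Suc i)})"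
  unfolding e1_def[abs_def]
  by (rule DERIV_cong[OF DERIV_diff[OF state_derivatives(1)[OF t] output_derivative[OF t]]])
    (simp add: output_rhs_def e2_def \<eta>_def algebra_simps)

lemma e2_derivative:
  assumes t: "t \<in> {\<tau> i..<\<tau> (Suc i)}"
  shows "(e2 has_real_derivative mismatch t - k2 * (e1 t - \<eta> t)) (at t within {\<tau> i..<\<tau> (Suc i)})"
proof -
  have t0: "0 \<le> t" and sub: "{\<tau> i..<\<tau> (Suc i)} \<subseteq> {0..}" using t tau_nonneg[of i] by auto
  show ?thesis
    unfolding e2_def[abs_def]
    by (rule DERIV_cong[OF DERIV_diff[OF state_derivatives(2)[OF t] has_field_derivative_subset[OF x_ode[OF t0] sub]]])
      (simp add: mismatch_def \<eta>_def e1_def)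
qed

lemma \<eta>_derivative:
  assumes t: "t \<in> {\<tau> i..<\<tau> (Suc i)}"
  shows "(\<eta> has_real_derivative output_error t) (at t within {\<tau> i..<\<tau> (Suc i)})"
proof -
  have "(w has_real_derivative output_rhs z t) (at t within {\<tau> i..<\<tau> (Suc i)})"
    using observer t unfolding observer_solution_def output_rhs_def by blast
  from DERIV_diff[OF this output_derivative[OF t]] show ?thesis
    unfolding \<eta>_def[abs_def]
    by (rule DERIV_cong) (simp add: output_rhs_def e1_def e2_def algebra_simps)
qed

lemma \<eta>_sample: "\<eta> (\<tau> i) = \<xi> (\<tau> i)"
  using observer y_eq[OF tau_nonneg] by (simp add: \<eta>_def observer_solution_def)

lemma p_derivative:
  assumes t: "t \<in> {\<tau> i..<\<tau> (Suc i)}"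
  shows "(p has_real_derivative (mismatch t + lam * \<zeta> * exp (- \<zeta> * r) * e2 (t - r)
    - lam * (lam * \<zeta> - \<zeta>) * \<eta> t) - lam * \<zeta> * p t) (at t within {\<tau> i..<\<tau> (Suc i)})"
  unfolding p_def[abs_def]
  by (rule DERIV_cong[OF DERIV_diff[OF e2_derivative[OF t] DERIV_cmult[OF e1_derivative[OF t]]]])
    (simp add: k1_eq k2_eq algebra_simps)

lemma e2_derivative_damped:
  assumes t: "t \<in> {\<tau> i..<\<tau> (Suc i)}"
  shows "(e2 has_real_derivative (b * p t + mismatch t + b * lam * \<eta> t) - b * e2 t)
    (at t within {\<tau> i..<\<tau> (Suc i)})"
  by (rule DERIV_cong[OF e2_derivative[OF t]]) (simp add: k2_eq p_def algebra_simps)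

lemma mismatch_bound:
  assumes t: "0 \<le> t" and B: "\<And>s. s \<in> {t - r..t} \<Longrightarrow> \<bar>e2 s\<bar> \<le> B"
  shows "\<bar>mismatch t\<bar> \<le> (K + \<mu> + 1 + \<mu> * \<zeta> * r) * B"
  unfolding mismatch_def
  by (rule reactor_rhs_lipschitz[OF continuous_on_nth[OF z_cont] x_cont t])
    (use B in \<open>simp add: e2_def\<close>)

text \<open>
  At the last sampling time \<open>\<eta>\<close> is the noise, and since then it has changed by at most \<open>\<delta>\<close> times the
  largest recent \<open>output_error\<close>; there \<open>e1 = (e2 - p) / lam\<close>. As a sampling period is at most
  \<open>1\<close>, moving the exponential weight from the past to the present costs at most \<open>exp \<omega>\<close>.
\<close>
lemma \<eta>_bound:
  assumes S2: "\<And>s. s \<in> {-r..T} \<Longrightarrow> \<bar>e2 s\<bar> \<le> S2 * exp (- \<omega> * s)"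
    and Sp: "\<And>s. s \<in> {0..T} \<Longrightarrow> \<bar>p s\<bar> \<le> Sp * exp (- \<omega> * s)"
    and X: "\<And>s. s \<in> {0..T} \<Longrightarrow> \<bar>\<xi> s\<bar> \<le> X * exp (- \<omega> * s)"
    and nonneg: "0 \<le> S2" "0 \<le> Sp" "0 \<le> X" and t: "t \<in> {0..T}"
  shows "\<bar>\<eta> t\<bar> \<le> exp \<omega> * (X + \<delta> * (\<zeta> * (1 + exp (\<omega> * r) + 1 / lam) * (S2 + Sp))) * exp (- \<omega> * t)"
proof -
  define D where "D = \<zeta> * (1 + exp (\<omega> * r) + 1 / lam)"
  define i where "i = current t"
  have i: "t \<in> {\<tau> i..<\<tau> (Suc i)}" unfolding i_def using t by (intro current_interval) auto
  have D0: "0 \<le> D" using zeta_pos lam_pos by (simp add: D_def)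
  have recent: "exp (- \<omega> * s) \<le> exp \<omega> * exp (- \<omega> * t)" if "s \<in> {\<tau> i..t}" for s
  proof -
    have "t - s \<le> 1" using that i tau_step(2)[of i] fast_sampling(1) by simp
    then have "\<omega> * (t - s) \<le> \<omega> * 1" using omega_pos by (intro mult_left_mono) auto
    then show ?thesis by (simp add: algebra_simps flip: exp_add)
  qed
  have rate: "\<bar>output_error s\<bar> \<le> D * (S2 + Sp) * (exp \<omega> * exp (- \<omega> * t))" if s: "s \<in> {\<tau> i..t}" for s
  proof -
    define E where "E = exp (- \<omega> * s)"
    have s0: "0 \<le> s" "s \<le> T" using s t tau_nonneg[of i] by auto
    have now: "\<bar>e2 s\<bar> \<le> S2 * E" and pnow: "\<bar>p s\<bar> \<le> Sp * E"
      using S2[of s] Sp[of s] s0 r_pos by (auto simp: E_def)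
    have "\<bar>e2 (s - r)\<bar> \<le> S2 * exp (- \<omega> * (s - r))" using S2[of "s - r"] s0 r_pos by simp
    also have "\<dots> = S2 * exp (\<omega> * r) * E" by (simp add: E_def algebra_simps flip: exp_add)
    finally have past: "\<bar>e2 (s - r)\<bar> \<le> S2 * exp (\<omega> * r) * E" .
    have "exp (- \<zeta> * r) \<le> 1" using zeta_pos r_pos by simp
    then have delayed: "\<bar>exp (- \<zeta> * r) * e2 (s - r)\<bar> \<le> 1 * (S2 * exp (\<omega> * r) * E)"
      unfolding abs_mult using past by (intro mult_mono) auto
    have "lam * \<bar>e1 s\<bar> = \<bar>e2 s - p s\<bar>" using lam_pos by (simp add: p_def abs_mult)
    also have "\<dots> \<le> (S2 + Sp) * E" using now pnow by (simp add: distrib_right)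
    finally have e1: "\<bar>e1 s\<bar> \<le> 1 / lam * ((S2 + Sp) * E)" using lam_pos by (simp add: field_simps)
    have "output_error s = \<zeta> * (e2 s - exp (- \<zeta> * r) * e2 (s - r) - e1 s)"
      by (simp add: algebra_simps)
    then have "\<bar>output_error s\<bar> = \<zeta> * \<bar>e2 s - exp (- \<zeta> * r) * e2 (s - r) - e1 s\<bar>"
      using zeta_pos by (simp only: abs_mult abs_of_pos)
    also have "\<dots> \<le> \<zeta> * (S2 * E + S2 * exp (\<omega> * r) * E + 1 / lam * ((S2 + Sp) * E))"
      using now delayed e1 zeta_pos by (intro mult_left_mono) auto
    also have "\<dots> \<le> \<zeta> * ((S2 + Sp) * E + (S2 + Sp) * exp (\<omega> * r) * E + 1 / lam * ((S2 + Sp) * E))"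
      using nonneg zeta_pos by (intro mult_left_mono add_mono mult_right_mono) (auto simp: E_def)
    also have "\<dots> = D * (S2 + Sp) * E" by (simp add: D_def algebra_simps add_divide_distrib)
    also have "\<dots> \<le> D * (S2 + Sp) * (exp \<omega> * exp (- \<omega> * t))"
      unfolding E_def using recent[OF s] D0 nonneg by (intro mult_left_mono) auto
    finally show ?thesis .
  qed
  have "norm (\<eta> t - \<eta> (\<tau> i)) \<le> D * (S2 + Sp) * (exp \<omega> * exp (- \<omega> * t)) * norm (t - \<tau> i)"
  proof (rule field_differentiable_bound[where f = \<eta> and f' = output_error and S = "{\<tau> i..t}"])
    fix s assume s: "s \<in> {\<tau> i..t}"
    show "(\<eta> has_real_derivative output_error s) (at s within {\<tau> i..t})"
      by (rule has_field_derivative_subset[OF \<eta>_derivative]) (use s i in auto)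
    show "norm (output_error s) \<le> D * (S2 + Sp) * (exp \<omega> * exp (- \<omega> * t))"
      using rate[OF s] by simp
  qed (use i in auto)
  also have "\<dots> \<le> D * (S2 + Sp) * (exp \<omega> * exp (- \<omega> * t)) * \<delta>"
    using i tau_step(2)[of i] D0 nonneg by (intro mult_left_mono) auto
  finally have drift: "\<bar>\<eta> t - \<xi> (\<tau> i)\<bar> \<le> D * (S2 + Sp) * (exp \<omega> * exp (- \<omega> * t)) * \<delta>"
    by (simp add: \<eta>_sample)
  have "\<bar>\<xi> (\<tau> i)\<bar> \<le> X * exp (- \<omega> * \<tau> i)"
    using X[of "\<tau> i"] i t tau_nonneg[of i] by simp
  also have "\<dots> \<le> X * (exp \<omega> * exp (- \<omega> * t))"
    using nonneg recent[of "\<tau> i"] i by (intro mult_left_mono) auto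
  finally have "\<bar>\<eta> t\<bar> \<le> X * (exp \<omega> * exp (- \<omega> * t)) + D * (S2 + Sp) * (exp \<omega> * exp (- \<omega> * t)) * \<delta>"
    using drift by linarith
  also have "\<dots> = exp \<omega> * (X + \<delta> * (D * (S2 + Sp))) * exp (- \<omega> * t)"
    by (simp add: algebra_simps)
  finally show ?thesis by (simp add: D_def)
qed

text \<open>
  With \<open>S2\<close> and \<open>Sp\<close> the weighted suprema of \<open>e2\<close> and \<open>p\<close>, the two damped equations bound \<open>Sp\<close> by
  \<open>\<kappa> S2\<close> and \<open>(1 + \<kappa>) / 2 * S2\<close> by \<open>Sp\<close>, up to the initial errors and the weighted supremum \<open>H\<close> of
  \<open>\<eta>\<close>, and the loop closes by \<open>small_gain\<close>.
\<close>
lemma error_decay: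
  assumes N: "\<And>s. s \<in> {-r..0} \<Longrightarrow> \<bar>e2 s\<bar> \<le> N" and p0: "\<bar>p 0\<bar> \<le> N"
    and X: "\<And>s. s \<in> {0..T} \<Longrightarrow> \<bar>\<xi> s\<bar> \<le> X * exp (- \<omega> * s)" and X0: "0 \<le> X" and T: "0 \<le> T"
    and t: "t \<in> {-r..T}"
  shows "\<bar>e2 t\<bar> \<le> (12 * N + 24 * lam * exp \<omega> * X) / (1 - \<kappa>) * exp (- \<omega> * t)"
proof -
  define a where "a = lam * \<zeta>"
  define C where "C = (K + \<mu> + 1 + \<mu> * \<zeta> * r) * exp (\<omega> * r)"
  have C0: "0 \<le> C"
    using lipschitz_on_nonneg[OF theta_lipschitz] mu_pos zeta_pos r_pos by (simp add: C_def)
  have a: "0 < \<omega>" "\<omega> < a" "a \<le> 2 * (a - \<omega>)" "\<zeta> \<le> a" "0 < a"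
  proof -
    have "2 * \<omega> \<le> a" using slow by (simp only: a_def)
    moreover have "1 * \<zeta> \<le> a"
      unfolding a_def using lam_ge_1 zeta_pos by (intro mult_right_mono) auto
    ultimately show "0 < \<omega>" "\<omega> < a" "a \<le> 2 * (a - \<omega>)" "\<zeta> \<le> a" "0 < a"
      using omega_pos zeta_pos by simp_all
  qed
  have b: "\<omega> < b"
  proof -
    have "0 < b * ((1 + \<kappa>) / 2)" using b_pos kappa by (intro mult_pos_pos) auto
    also have "\<dots> \<le> b - \<omega> - C" using second_gain by (simp only: C_def)
    finally show ?thesis using C0 by simp
  qed
  have N0: "0 \<le> N" using p0 by (rule order_trans[OF abs_ge_zero])
  obtain s2 where s2: "s2 \<in> {-r..T}"
    and e2_max: "\<And>t. t \<in> {-r..T} \<Longrightarrow> \<bar>e2 t\<bar> \<le> \<bar>e2 s2\<bar> * exp (\<omega> * s2) * exp (- \<omega> * t)"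
    using weighted_maximum[OF continuous_on_subset[OF e2_cont], of "-r" T] T r_pos by auto
  obtain sp where sp: "sp \<in> {0..T}"
    and p_max: "\<And>t. t \<in> {0..T} \<Longrightarrow> \<bar>p t\<bar> \<le> \<bar>p sp\<bar> * exp (\<omega> * sp) * exp (- \<omega> * t)"
    using weighted_maximum[OF continuous_on_subset[OF p_cont], of 0 T] T by auto
  define S2 where "S2 = \<bar>e2 s2\<bar> * exp (\<omega> * s2)"
  define Sp where "Sp = \<bar>p sp\<bar> * exp (\<omega> * sp)"
  have S0: "0 \<le> S2" "0 \<le> Sp" by (simp_all add: S2_def Sp_def)
  define \<epsilon> where "\<epsilon> = exp \<omega> * \<delta> * (\<zeta> * (1 + exp (\<omega> * r) + 1 / lam))"
  define H where "H = exp \<omega> * X + \<epsilon> * (S2 + Sp)"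
  have \<epsilon>0: "0 \<le> \<epsilon>" using delta_pos zeta_pos lam_pos by (simp add: \<epsilon>_def add_nonneg_nonneg)
  then have H0: "0 \<le> H" using X0 S0 by (simp add: H_def)
  have eta: "\<bar>\<eta> s\<bar> \<le> H * exp (- \<omega> * s)" if "s \<in> {0..T}" for s
    using \<eta>_bound[OF _ _ X S0 X0 that] e2_max p_max
    by (simp add: S2_def Sp_def H_def \<epsilon>_def algebra_simps)
  \<comment> \<open>Looking back by at most the delay costs the factor \<open>exp (\<omega> r)\<close>.\<close>
  have past: "\<bar>e2 s'\<bar> \<le> S2 * exp (\<omega> * r) * exp (- \<omega> * s)" if s: "s \<in> {0..T}" "s' \<in> {s - r..s}" for s s'
  proof -
    have "\<bar>e2 s'\<bar> \<le> S2 * exp (- \<omega> * s')" using e2_max[of s'] s unfolding S2_def by simp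
    also have "\<dots> \<le> S2 * exp (\<omega> * r - \<omega> * s)"
    proof -
      have "\<omega> * (s - r) \<le> \<omega> * s'" using s omega_pos by (intro mult_left_mono) auto
      then show ?thesis using S0 by (intro mult_left_mono) (auto simp: algebra_simps)
    qed
    also have "\<dots> = S2 * exp (\<omega> * r) * exp (- \<omega> * s)" by (simp flip: exp_add)
    finally show ?thesis .
  qed
  have mism: "\<bar>mismatch s\<bar> \<le> C * S2 * exp (- \<omega> * s)" if s: "s \<in> {0..T}" for s
  proof -
    have "\<bar>mismatch s\<bar> \<le> (K + \<mu> + 1 + \<mu> * \<zeta> * r) * (S2 * exp (\<omega> * r) * exp (- \<omega> * s))"
      using s by (intro mismatch_bound past) auto
    then show ?thesis by (simp add: C_def mult.assoc mult.left_commute)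
  qed
  have first: "Sp \<le> N + \<kappa> * S2 + 2 * (lam * H)"
  proof -
    have "\<bar>p sp\<bar> \<le> (\<bar>p 0\<bar> + (\<kappa> * (a - \<omega>) * S2 + lam * a * H) / (a - \<omega>)) * exp (- \<omega> * sp)"
    proof (rule damped_equation_bound[OF p_cont _ _ a(1,2) sp])
      show "(p has_real_derivative (mismatch t + lam * \<zeta> * exp (- \<zeta> * r) * e2 (t - r)
          - lam * (lam * \<zeta> - \<zeta>) * \<eta> t) - a * p t) (at t within {\<tau> i..<\<tau> (Suc i)})"
        if "t \<in> {\<tau> i..<\<tau> (Suc i)}" for i t
        using p_derivative[OF that] by (simp only: a_def)
      fix s assume s: "s \<in> {0..T}"
      define E where "E = exp (- \<omega> * s)"
      have "\<bar>e2 (s - r)\<bar> \<le> S2 * exp (\<omega> * r) * E"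
        using past[OF s, of "s - r"] r_pos by (simp add: E_def)
      then have 1: "\<bar>lam * \<zeta> * exp (- \<zeta> * r) * e2 (s - r)\<bar> \<le> lam * \<zeta> * exp (- \<zeta> * r) * (S2 * exp (\<omega> * r) * E)"
        using lam_pos zeta_pos by (simp add: abs_mult)
      have "\<bar>lam * (lam * \<zeta> - \<zeta>) * \<eta> s\<bar> = lam * (a - \<zeta>) * \<bar>\<eta> s\<bar>"
        using lam_pos a by (simp add: abs_mult a_def)
      also have "\<dots> \<le> lam * a * (H * E)"
        using eta[OF s] lam_pos a zeta_pos unfolding E_def by (intro mult_mono) auto
      finally have 2: "\<bar>lam * (lam * \<zeta> - \<zeta>) * \<eta> s\<bar> \<le> lam * a * (H * E)" .
      have "\<bar>mismatch s + lam * \<zeta> * exp (- \<zeta> * r) * e2 (s - r) - lam * (lam * \<zeta> - \<zeta>) * \<eta> s\<bar>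
          \<le> C * S2 * E + lam * \<zeta> * exp (- \<zeta> * r) * (S2 * exp (\<omega> * r) * E) + lam * a * (H * E)"
        using mism[OF s] 1 2 unfolding E_def by linarith
      also have "\<dots> = ((C + lam * \<zeta> * (exp (- \<zeta> * r) * exp (\<omega> * r))) * S2 + lam * a * H) * E"
        by (simp add: algebra_simps)
      also have "\<dots> \<le> (\<kappa> * (a - \<omega>) * S2 + lam * a * H) * E"
        using mult_right_mono[OF first_gain S0(1)] by (simp add: C_def a_def E_def)
      finally show "\<bar>mismatch s + lam * \<zeta> * exp (- \<zeta> * r) * e2 (s - r) - lam * (lam * \<zeta> - \<zeta>) * \<eta> s\<bar>
          \<le> (\<kappa> * (a - \<omega>) * S2 + lam * a * H) * exp (- \<omega> * s)"
        by (simp only: E_def)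
    qed
    then have "Sp \<le> (\<bar>p 0\<bar> + (\<kappa> * (a - \<omega>) * S2 + lam * a * H) / (a - \<omega>)) * exp (- \<omega> * sp) * exp (\<omega> * sp)"
      unfolding Sp_def by (rule mult_right_mono) simp
    also have "\<dots> = \<bar>p 0\<bar> + (\<kappa> * (a - \<omega>) * S2 + lam * a * H) / (a - \<omega>)"
      by (simp add: exp_minus)
    also have "\<dots> = \<bar>p 0\<bar> + \<kappa> * S2 + lam * a * H / (a - \<omega>)"
      using a by (simp add: add_divide_distrib)
    also have "lam * a * H / (a - \<omega>) \<le> 2 * (lam * H)"
    proof -
      have "lam * H * a \<le> lam * H * (2 * (a - \<omega>))"
        using a lam_pos H0 by (intro mult_left_mono) auto
      then show ?thesis using a by (simp add: pos_divide_le_eq algebra_simps)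
    qed
    finally show ?thesis using p0 by simp
  qed
  have S2_le: "S2 \<le> N + (b * Sp + C * S2 + b * lam * H) / (b - \<omega>)"
  \<comment> \<open>If the maximum lies in the history, it is bounded by the initial error alone.\<close>
  proof (cases "0 \<le> s2")
    case True
    have "\<bar>e2 s2\<bar> \<le> (\<bar>e2 0\<bar> + (b * Sp + C * S2 + b * lam * H) / (b - \<omega>)) * exp (- \<omega> * s2)"
    proof (rule damped_equation_bound[where T = T,
          OF continuous_on_subset[OF e2_cont nonneg_subset] e2_derivative_damped _ a(1) b])
      fix s assume s: "s \<in> {0..T}"
      have 1: "\<bar>b * p s\<bar> \<le> b * (Sp * exp (- \<omega> * s))"
        using p_max[OF s] b_pos by (simp add: abs_mult Sp_def)
      have 2: "\<bar>b * lam * \<eta> s\<bar> \<le> b * lam * (H * exp (- \<omega> * s))"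
        using eta[OF s] b_pos lam_pos by (simp add: abs_mult)
      have "\<bar>b * p s + mismatch s + b * lam * \<eta> s\<bar>
          \<le> b * (Sp * exp (- \<omega> * s)) + C * S2 * exp (- \<omega> * s) + b * lam * (H * exp (- \<omega> * s))"
        using 1 2 mism[OF s] by linarith
      then show "\<bar>b * p s + mismatch s + b * lam * \<eta> s\<bar> \<le> (b * Sp + C * S2 + b * lam * H) * exp (- \<omega> * s)"
        by (simp add: algebra_simps)
    qed (use True s2 in auto)
    then have "S2 \<le> (\<bar>e2 0\<bar> + (b * Sp + C * S2 + b * lam * H) / (b - \<omega>)) * exp (- \<omega> * s2) * exp (\<omega> * s2)"
      unfolding S2_def by (rule mult_right_mono) simp
    also have "\<dots> = \<bar>e2 0\<bar> + (b * Sp + C * S2 + b * lam * H) / (b - \<omega>)"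
      by (simp add: exp_minus)
    finally show ?thesis using N[of 0] r_pos by simp
  next
    case False
    then have "\<bar>e2 s2\<bar> * exp (\<omega> * s2) \<le> N * 1"
      using N[of s2] s2 omega_pos N0 by (intro mult_mono) (auto simp: mult_nonneg_nonpos)
    moreover have "0 \<le> (b * Sp + C * S2 + b * lam * H) / (b - \<omega>)"
      using b b_pos S0 C0 lam_pos H0 by simp
    ultimately show ?thesis by (simp add: S2_def)
  qed
  have second: "(1 + \<kappa>) / 2 * S2 \<le> N + Sp + lam * H"
  proof -
    have "S2 - N \<le> (b * Sp + C * S2 + b * lam * H) / (b - \<omega>)" using S2_le by simp
    then have "(S2 - N) * (b - \<omega>) \<le> b * Sp + C * S2 + b * lam * H"
      using b by (simp add: pos_le_divide_eq)
    then have "(b - \<omega> - C) * S2 \<le> (b - \<omega>) * N + b * Sp + b * lam * H"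
      by (simp add: algebra_simps)
    moreover have "(b - \<omega>) * N \<le> b * N" using omega_pos N0 by (intro mult_right_mono) auto
    moreover have "b * ((1 + \<kappa>) / 2) * S2 \<le> (b - \<omega> - C) * S2"
      using second_gain S0 by (intro mult_right_mono) (auto simp: C_def)
    ultimately have "b * ((1 + \<kappa>) / 2) * S2 \<le> b * N + b * Sp + b * lam * H"
      by linarith
    then have "b * ((1 + \<kappa>) / 2 * S2) \<le> b * (N + Sp + lam * H)"
      by (simp only: distrib_left mult.assoc)
    then show ?thesis using b_pos by simp
  qed
  have small: "48 * lam * \<epsilon> \<le> 1 - \<kappa>"
    using fast_sampling(2) by (simp add: \<epsilon>_def mult.assoc mult.left_commute mult.commute)
  have "S2 \<le> (12 * N + 24 * lam * exp \<omega> * X) / (1 - \<kappa>)"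
    by (rule small_gain[OF kappa N0 S0(1) H0 lam_pos \<epsilon>0 first second _ small]) (simp add: H_def)
  then have "S2 * exp (- \<omega> * t) \<le> (12 * N + 24 * lam * exp \<omega> * X) / (1 - \<kappa>) * exp (- \<omega> * t)"
    by (rule mult_right_mono) simp
  with e2_max[OF t] show ?thesis unfolding S2_def by (rule order_trans)
qed

end

section \<open>The closed loop\<close>

lemma sup_norm01_upper:
  assumes "continuous_on {0..1} f" "y \<in> {0..1}"
  shows "\<bar>f y\<bar> \<le> sup_norm01 f"
proof -
  have "compact ((\<lambda>y. \<bar>f y\<bar>) ` {0..1})"
    by (intro compact_continuous_image continuous_intros assms) auto
  then have "bdd_above ((\<lambda>y. \<bar>f y\<bar>) ` {0..1})"
    by (intro bounded_imp_bdd_above compact_imp_bounded)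
  then show ?thesis unfolding sup_norm01_def by (rule cSUP_upper[OF assms(2)])
qed

lemma sup_norm01_least:
  assumes "\<And>y. y \<in> {0..1} \<Longrightarrow> \<bar>f y\<bar> \<le> B"
  shows "sup_norm01 f \<le> B"
  unfolding sup_norm01_def by (rule cSUP_least) (use assms in auto)

lemma history_norm_upper:
  assumes "continuous_on {-r..0} z0" "s \<in> {-r..0}"
  shows "norm (z0 s) \<le> history_norm r z0"
proof -
  have "compact ((\<lambda>s. norm (z0 s)) ` {-r..0})"
    by (intro compact_continuous_image continuous_intros assms) auto
  then have "bdd_above ((\<lambda>s. norm (z0 s)) ` {-r..0})"
    by (intro bounded_imp_bdd_above compact_imp_bounded)
  then show ?thesis unfolding history_norm_def by (rule cSUP_upper[OF assms(2)])
qed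

text \<open>
  Local boundedness makes the weighted supremum of the noise a genuine upper bound; it is rewritten as
  a multiple of \<open>exp (- \<omega> s)\<close> that is uniform in \<open>s \<le> t\<close>.
\<close>
lemma weighted_noise_bound:
  assumes \<xi>: "Linf_loc \<xi>" and \<omega>: "0 < \<omega>" and s: "s \<in> {0..t}"
  shows "\<bar>\<xi> s\<bar> \<le> exp (\<omega> * t) * (SUP s\<in>{0..t}. \<bar>\<xi> s\<bar> * exp (- \<omega> * (t - s))) * exp (- \<omega> * s)"
proof -
  have "bounded (\<xi> ` {0..t})" using \<xi> s by (simp add: Linf_loc_def)
  then obtain B where B: "\<forall>s\<in>{0..t}. \<bar>\<xi> s\<bar> \<le> B" by (auto simp: bounded_real)
  have "bdd_above ((\<lambda>s. \<bar>\<xi> s\<bar> * exp (- \<omega> * (t - s))) ` {0..t})"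
  proof (rule bdd_aboveI2)
    fix s assume s: "s \<in> {0..t}"
    have "\<bar>\<xi> s\<bar> * exp (- \<omega> * (t - s)) \<le> \<bar>\<xi> s\<bar> * 1"
      using s \<omega> by (intro mult_left_mono) auto
    with B s show "\<bar>\<xi> s\<bar> * exp (- \<omega> * (t - s)) \<le> B" by fastforce
  qed
  note upper = cSUP_upper[OF s this]
  have "exp (- \<omega> * (t - s)) * (exp (\<omega> * t) * exp (- \<omega> * s)) = 1"
    by (simp add: algebra_simps flip: exp_add)
  then have "\<bar>\<xi> s\<bar> = \<bar>\<xi> s\<bar> * exp (- \<omega> * (t - s)) * (exp (\<omega> * t) * exp (- \<omega> * s))"
    by (simp only: mult.assoc mult_1_right)
  also have "\<dots> \<le> (SUP s\<in>{0..t}. \<bar>\<xi> s\<bar> * exp (- \<omega> * (t - s))) * (exp (\<omega> * t) * exp (- \<omega> * s))"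
    using upper by (rule mult_right_mono) simp
  finally show ?thesis by (simp only: ac_simps)
qed

text \<open>
  The rate \<open>\<omega> = \<zeta>/2\<close> makes the delayed gain \<open>\<sigma> = exp (- \<zeta> r) exp (\<omega> r)\<close> smaller than one, and
  \<open>\<kappa>\<close> is taken halfway between \<open>\<sigma>\<close> and \<open>1\<close>. The margin \<open>\<kappa> - \<sigma>\<close> determines how large \<open>lam\<close> must
  be, the margin \<open>1 - \<kappa>\<close> then determines \<open>b\<close>, and \<open>\<delta>\<close> comes last.
\<close>
lemma tuned_constants:
  fixes C \<zeta> r :: real
  assumes C: "0 \<le> C" and \<zeta>: "0 < \<zeta>" and r: "0 < r"
  obtains lam b \<omega> \<kappa> \<delta> :: real where "0 < \<omega>" "0 < \<kappa>" "\<kappa> < 1" "1 \<le> lam" "0 < b" "0 < \<delta>" "\<delta> \<le> 1"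
    and "2 * \<omega> \<le> lam * \<zeta>"
    and "C * exp (\<omega> * r) + lam * \<zeta> * (exp (- \<zeta> * r) * exp (\<omega> * r)) \<le> \<kappa> * (lam * \<zeta> - \<omega>)"
    and "b * ((1 + \<kappa>) / 2) \<le> b - \<omega> - C * exp (\<omega> * r)"
    and "48 * lam * exp \<omega> * \<zeta> * (1 + exp (\<omega> * r) + 1 / lam) * \<delta> \<le> 1 - \<kappa>"
proof -
  define \<omega> where "\<omega> = \<zeta> / 2"
  define C' where "C' = C * exp (\<omega> * r)"
  define \<sigma> where "\<sigma> = exp (- \<zeta> * r) * exp (\<omega> * r)"
  define \<kappa> where "\<kappa> = (1 + \<sigma>) / 2"
  define a where "a = \<zeta> + 2 * (C' + \<omega>) / (1 - \<sigma>)"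
  define lam where "lam = a / \<zeta>"
  define b where "b = 2 * (\<omega> + C') / (1 - \<kappa>)"
  define D where "D = 48 * lam * exp \<omega> * \<zeta> * (1 + exp (\<omega> * r) + 1 / lam)"
  define \<delta> where "\<delta> = min 1 ((1 - \<kappa>) / D)"
  have \<omega>: "0 < \<omega>" using \<zeta> by (simp add: \<omega>_def)
  have C': "0 \<le> C'" using C by (simp add: C'_def)
  have "\<sigma> = exp (- (\<zeta> * r / 2))" by (simp add: \<sigma>_def \<omega>_def flip: exp_add)
  then have \<sigma>: "0 < \<sigma>" "\<sigma> < 1" using \<zeta> r by simp_all
  then have \<kappa>: "0 < \<kappa>" "\<kappa> < 1" by (simp_all add: \<kappa>_def)
  have a: "\<zeta> \<le> a" using C' \<omega> \<sigma> by (simp add: a_def)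
  have lam: "lam * \<zeta> = a" "1 \<le> lam" using a \<zeta> by (simp_all add: lam_def)
  have b: "0 < b" using C' \<omega> \<kappa> by (simp add: b_def)
  have D: "0 < D" using lam \<zeta> by (simp add: D_def add_pos_pos)
  have first: "C' + a * \<sigma> \<le> \<kappa> * (a - \<omega>)"
  proof -
    have "\<kappa> * (a - \<omega>) - a * \<sigma> = a * (1 - \<sigma>) / 2 - \<kappa> * \<omega>" by (simp add: \<kappa>_def field_simps)
    moreover have "a * (1 - \<sigma>) / 2 = \<zeta> * (1 - \<sigma>) / 2 + (C' + \<omega>)"
      using \<sigma> by (simp add: a_def field_simps)
    moreover have "0 \<le> \<zeta> * (1 - \<sigma>) / 2" using \<zeta> \<sigma> by simp
    moreover have "\<kappa> * \<omega> \<le> 1 * \<omega>" using \<kappa> \<omega> by (intro mult_right_mono) auto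
    ultimately show ?thesis by linarith
  qed
  have second: "b * ((1 + \<kappa>) / 2) = b - \<omega> - C'"
  proof -
    have "b * (1 - \<kappa>) = 2 * (\<omega> + C')" using \<kappa> by (simp add: b_def)
    then show ?thesis by (simp add: field_simps)
  qed
  have "D * \<delta> \<le> D * ((1 - \<kappa>) / D)" using D by (intro mult_left_mono) (auto simp: \<delta>_def)
  then have third: "D * \<delta> \<le> 1 - \<kappa>" using D by simp
  show ?thesis
  proof (rule that[of \<omega> \<kappa> lam b \<delta>])
    show "2 * \<omega> \<le> lam * \<zeta>" using a by (simp add: lam \<omega>_def)
    show "0 < \<delta>" "\<delta> \<le> 1" using D \<kappa> by (simp_all add: \<delta>_def)
  qed (use \<omega> \<kappa> lam b first second third in \<open>simp_all add: C'_def \<sigma>_def D_def\<close>)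
qed

context reactor
begin

lemma reactor_well_posed:
  assumes v0: "C1_on {0..1} v0" "v0 0 = 0" "c * deriv01 v0 0 = \<zeta> * x0"
  obtains q where "with_history r (past_input v0) q"
    and "\<And>t. 0 \<le> t \<Longrightarrow> (q has_real_derivative reactor_rhs q t) (at t within {0..})"
    and "reactor_solution c \<mu> \<zeta> \<theta> u x0 v0 q (memory q)"
    and "\<And>x v t. reactor_solution c \<mu> \<zeta> \<theta> u x0 v0 x v \<Longrightarrow> 0 \<le> t \<Longrightarrow>
      x t = q t \<and> (\<forall>y\<in>{0..1}. v t y = memory q t y)"
proof -
  note past = continuous_on_past_input[OF v0(1)]
  obtain q where q: "with_history r (past_input v0) q"
    and ode: "\<And>t. 0 \<le> t \<Longrightarrow> (q has_real_derivative reactor_rhs q t) (at t within {0..})"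
    using reactor_delay_equation_exists[OF past] by blast
  have "q 0 = past_input v0 0" using q r_pos by (simp add: with_history_def)
  then have "q 0 = x0" using v0(3) zeta_pos by (simp add: past_input_def)
  with reactor_solution_of_delay_equation[OF v0(1,2) q ode]
  have sol: "reactor_solution c \<mu> \<zeta> \<theta> u x0 v0 q (memory q)" by simp
  have unique: "x t = q t \<and> (\<forall>y\<in>{0..1}. v t y = memory q t y)"
    if xv: "reactor_solution c \<mu> \<zeta> \<theta> u x0 v0 x v" and t: "0 \<le> t" for x v t
  proof -
    note delay = delay_equation_of_reactor_solution[OF v0 xv]
    have eq: "(if s < 0 then past_input v0 s else x s) = q s" if "-r \<le> s" for s
      by (rule reactor_delay_equation_unique[OF past delay(1,3) q ode that])
    show ?thesis
      using eq[of t] delay(2)[OF t] memory_cong[OF eq t] t r_pos by simp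
  qed
  show ?thesis by (rule that[OF q _ sol]) (rule ode unique; assumption)+
qed

end

context observer_error
begin

text \<open>
  The initial errors are bounded by the norms of the initial data, where the continued past of \<open>x\<close>
  involves the derivative of \<open>v0\<close>. The estimate is then \<open>error_decay\<close> on \<open>[0, t]\<close>, with a noise
  bound that may depend on \<open>t\<close>.
\<close>
lemma estimation_error_bound:
  assumes v0: "C1_on {0..1} v0" "v0 0 = 0" and x: "with_history r (past_input v0) x"
    and z0: "continuous_on {-r..0} z0" and \<xi>: "Linf_loc \<xi>"
    and v: "\<And>y. y \<in> {0..1} \<Longrightarrow> v y = memory x t y" and t: "0 \<le> t"
  shows "\<bar>x t - z t $ 2\<bar> + sup_norm01 (\<lambda>y. v y - profile_estimate r \<zeta> z t y)
    \<le> exp (- \<omega> * t) * ((1 + \<zeta> * r * exp (\<omega> * r)) * 12 * (1 + c / \<zeta> * exp (\<zeta> * r) + lam) / (1 - \<kappa>)) *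
        (sup_norm01 v0 + sup_norm01 (deriv01 v0) + \<bar>x0\<bar> + history_norm r z0)
      + (1 + \<zeta> * r * exp (\<omega> * r)) * 24 * lam * exp \<omega> / (1 - \<kappa>)
        * (SUP s\<in>{0..t}. \<bar>\<xi> s\<bar> * exp (- \<omega> * (t - s)))"
proof -
  define A where "A = sup_norm01 v0 + sup_norm01 (deriv01 v0) + \<bar>x0\<bar> + history_norm r z0"
  define Y where "Y = (SUP s\<in>{0..t}. \<bar>\<xi> s\<bar> * exp (- \<omega> * (t - s)))"
  define N where "N = (1 + c / \<zeta> * exp (\<zeta> * r) + lam) * A"
  define X where "X = exp (\<omega> * t) * Y"
  define Q where "Q = (12 * N + 24 * lam * exp \<omega> * X) / (1 - \<kappa>)"
  have v0_cont: "continuous_on {0..1} v0" and dv0_cont: "continuous_on {0..1} (deriv01 v0)"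
    using v0(1) by (auto simp: C1_on_def intro: differentiable_imp_continuous_on)
  note v0_le = sup_norm01_upper[OF v0_cont] and dv0_le = sup_norm01_upper[OF dv0_cont]
    and z0_le = history_norm_upper[OF z0]
  have nonneg: "0 \<le> sup_norm01 v0" "0 \<le> sup_norm01 (deriv01 v0)" "0 \<le> history_norm r z0"
    using order_trans[OF abs_ge_zero v0_le[of 0]] order_trans[OF abs_ge_zero dv0_le[of 0]]
      order_trans[OF norm_ge_zero z0_le[of 0]] r_pos by simp_all
  have A: "sup_norm01 v0 + history_norm r z0 \<le> A" "sup_norm01 (deriv01 v0) \<le> A" "history_norm r z0 \<le> A" "0 \<le> A"
    using nonneg by (simp_all add: A_def)
  have z_hist: "z s = z0 s" if "s \<in> {-r..0}" for s
    using observer that by (simp add: observer_solution_def)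
  have past: "\<bar>x s\<bar> \<le> c / \<zeta> * exp (\<zeta> * r) * A" if s: "s \<in> {-r..0}" for s
  proof -
    have "\<bar>x s\<bar> = c / \<zeta> * exp (- \<zeta> * s) * \<bar>deriv01 v0 (- (c * s))\<bar>"
      using x s c_pos zeta_pos by (simp add: with_history_def past_input_def abs_mult)
    also have "\<dots> \<le> c / \<zeta> * exp (\<zeta> * r) * A"
    proof (intro mult_mono)
      have "\<zeta> * (- s) \<le> \<zeta> * r" using s zeta_pos by (intro mult_left_mono) auto
      then show "exp (- \<zeta> * s) \<le> exp (\<zeta> * r)" by simp
      show "\<bar>deriv01 v0 (- (c * s))\<bar> \<le> A"
        using dv0_le[OF past_window[OF s]] A(2) by (rule order_trans)
    qed (use c_pos zeta_pos in auto)
    finally show ?thesis .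
  qed
  have e2_hist: "\<bar>e2 s\<bar> \<le> (1 + c / \<zeta> * exp (\<zeta> * r)) * A" if s: "s \<in> {-r..0}" for s
  proof -
    have "\<bar>z s $ 2\<bar> \<le> A"
      using component_le_norm_cart[of "z0 s" 2] z0_le[OF s] A(3) by (simp add: z_hist[OF s])
    then show ?thesis using past[OF s] by (simp add: e2_def distrib_right)
  qed
  have N_e2: "\<bar>e2 s\<bar> \<le> N" if s: "s \<in> {-r..0}" for s
  proof -
    have "0 \<le> lam * A" using lam_pos A by simp
    then show ?thesis using e2_hist[OF s] by (simp add: N_def distrib_right)
  qed
  have N_p: "\<bar>p 0\<bar> \<le> N"
  proof -
    have "memory x 0 1 = v0 1" by (rule memory_past_input[OF v0 x]) simp
    then have "\<bar>e1 0\<bar> \<le> A"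
      using component_le_norm_cart[of "z0 0" 1] z0_le[of 0] v0_le[of 1] A(1) r_pos z_hist[of 0]
      by (simp add: e1_def)
    then have "\<bar>lam * e1 0\<bar> \<le> lam * A" using lam_pos by (simp add: abs_mult)
    then show ?thesis
      using e2_hist[of 0] r_pos by (simp add: p_def N_def distrib_right)
  qed
  have noise: "\<bar>\<xi> s\<bar> \<le> X * exp (- \<omega> * s)" if "s \<in> {0..t}" for s
    unfolding X_def Y_def by (rule weighted_noise_bound[OF \<xi> omega_pos that])
  have X0: "0 \<le> X"
    using order_trans[OF abs_ge_zero noise[of 0]] t by simp
  have decay: "\<bar>e2 s\<bar> \<le> Q * exp (- \<omega> * s)" if "s \<in> {-r..t}" for s
    unfolding Q_def by (rule error_decay[OF N_e2 N_p noise X0 t that])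
  have N0: "0 \<le> N" using N_p by (rule order_trans[OF abs_ge_zero])
  have Q0: "0 \<le> Q" using N0 X0 lam_pos kappa by (simp add: Q_def)
  have recent: "\<bar>x s - z s $ 2\<bar> \<le> Q * exp (\<omega> * r) * exp (- \<omega> * t)" if s: "s \<in> {t - r..t}" for s
  proof -
    have "\<omega> * (t - r) \<le> \<omega> * s" using s omega_pos by (intro mult_left_mono) auto
    then have "exp (- \<omega> * s) \<le> exp (\<omega> * r) * exp (- \<omega> * t)"
      by (simp add: algebra_simps flip: exp_add)
    then have "Q * exp (- \<omega> * s) \<le> Q * (exp (\<omega> * r) * exp (- \<omega> * t))"
      using Q0 by (rule mult_left_mono)
    then show ?thesis using decay[of s] s t by (simp add: e2_def abs_minus_commute mult.assoc)
  qed
  note z2_cont = continuous_on_nth[OF z_cont, of 2]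
  have "sup_norm01 (\<lambda>y. v y - profile_estimate r \<zeta> z t y) \<le> \<zeta> * r * (Q * exp (\<omega> * r) * exp (- \<omega> * t))"
  proof (rule sup_norm01_least)
    fix y' :: real assume y': "y' \<in> {0..1}"
    have "v y' - profile_estimate r \<zeta> z t y' = memory (\<lambda>s. x s - z s $ 2) t y'"
      using memory_diff[OF x_cont z2_cont t y'] v[OF y']
      by (simp add: profile_estimate_def memory_def)
    then show "\<bar>v y' - profile_estimate r \<zeta> z t y'\<bar> \<le> \<zeta> * r * (Q * exp (\<omega> * r) * exp (- \<omega> * t))"
      using memory_bound[OF continuous_on_diff[OF x_cont z2_cont] t y' recent] by simp
  qed
  moreover have "\<bar>x t - z t $ 2\<bar> \<le> Q * exp (- \<omega> * t)"
    using decay[of t] t r_pos by (simp add: e2_def abs_minus_commute)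
  ultimately have "\<bar>x t - z t $ 2\<bar> + sup_norm01 (\<lambda>y. v y - profile_estimate r \<zeta> z t y)
      \<le> (1 + \<zeta> * r * exp (\<omega> * r)) * (Q * exp (- \<omega> * t))"
    by (simp add: algebra_simps)
  also have "\<dots> = exp (- \<omega> * t) * ((1 + \<zeta> * r * exp (\<omega> * r)) * 12 * (1 + c / \<zeta> * exp (\<zeta> * r) + lam) / (1 - \<kappa>)) * A
      + (1 + \<zeta> * r * exp (\<omega> * r)) * 24 * lam * exp \<omega> / (1 - \<kappa>) * (X * exp (- \<omega> * t))"
  proof -
    have "h * ((12 * (g * A) + 24 * lam * exp \<omega> * X) / (1 - \<kappa>) * E)
        = E * (h * 12 * g / (1 - \<kappa>)) * A + h * 24 * lam * exp \<omega> / (1 - \<kappa>) * (X * E)" for g h E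
      by (simp add: add_divide_distrib algebra_simps)
    then show ?thesis unfolding Q_def N_def .
  qed
  also have "X * exp (- \<omega> * t) = Y" by (simp add: X_def exp_minus)
  finally show ?thesis by (simp only: A_def Y_def)
qed

end

theorem theorem3p3:
  fixes c \<mu> \<zeta> r :: real and \<theta> :: "real \<Rightarrow> real"
  assumes "c > 0" and "\<mu> > 0" and "\<zeta> > 0" and "r = inverse c"
    and "\<theta> C1_differentiable_on UNIV" and "\<exists>L. L-lipschitz_on UNIV \<theta>" and "\<theta> 0 = 0"
  shows "\<exists>k1 k2 \<delta> P M \<omega>. k1 > 0 \<and> k2 > 0 \<and> \<delta> > 0 \<and> P > 0 \<and> M > 0 \<and> \<omega> > 0 \<and>
    (\<forall>\<tau> v0 x0 z0 u \<xi>.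
       sampling_sequence \<delta> \<tau> \<longrightarrow>
       C1_on {0..1} v0 \<longrightarrow> c * deriv01 v0 0 = \<zeta> * x0 \<longrightarrow> v0 0 = 0 \<longrightarrow>
       continuous_on {-r..0} z0 \<longrightarrow> continuous_on {0..} u \<longrightarrow> Linf_loc \<xi> \<longrightarrow>
       (\<exists>x v z w.
          closed_loop_solution c r \<mu> \<zeta> \<theta> k1 k2 \<tau> u \<xi> x0 v0 z0 x v z w \<and>
          (\<forall>x' v' z' w'. closed_loop_solution c r \<mu> \<zeta> \<theta> k1 k2 \<tau> u \<xi> x0 v0 z0 x' v' z' w' \<longrightarrow>
             (\<forall>t\<ge>0. x' t = x t \<and> (\<forall>y\<in>{0..1}. v' t y = v t y) \<and> w' t = w t) \<and>
             (\<forall>t\<ge>-r. z' t = z t)) \<and>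
          (\<forall>t\<ge>0.
             \<bar>x t - z t $ 2\<bar> + sup_norm01 (\<lambda>y. v t y - profile_estimate r \<zeta> z t y)
             \<le> exp (- \<omega> * t) * M *
                 (sup_norm01 v0 + sup_norm01 (deriv01 v0) + \<bar>x0\<bar> + history_norm r z0)
               + P * (SUP s\<in>{0..t}. \<bar>\<xi> s\<bar> * exp (- \<omega> * (t - s))))))"
proof -
  obtain K where K: "K-lipschitz_on UNIV \<theta>" using assms(6) by blast
  interpret transport_delay c r \<zeta> by unfold_locales (use assms in auto)
  have C: "0 \<le> K + \<mu> + 1 + \<mu> * \<zeta> * r"
    using lipschitz_on_nonneg[OF K] assms(2) zeta_pos r_pos by simp
  obtain lam b \<omega> \<kappa> \<delta> where tuned: "0 < \<omega>" "0 < \<kappa>" "\<kappa> < 1" "1 \<le> lam" "0 < b" "0 < \<delta>" "\<delta> \<le> 1"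
    "2 * \<omega> \<le> lam * \<zeta>"
    "(K + \<mu> + 1 + \<mu> * \<zeta> * r) * exp (\<omega> * r) + lam * \<zeta> * (exp (- \<zeta> * r) * exp (\<omega> * r)) \<le> \<kappa> * (lam * \<zeta> - \<omega>)"
    "b * ((1 + \<kappa>) / 2) \<le> b - \<omega> - (K + \<mu> + 1 + \<mu> * \<zeta> * r) * exp (\<omega> * r)"
    "48 * lam * exp \<omega> * \<zeta> * (1 + exp (\<omega> * r) + 1 / lam) * \<delta> \<le> 1 - \<kappa>"
    using tuned_constants[OF C zeta_pos r_pos] by metis
  define k1 k2 where "k1 = lam * \<zeta> + b - \<zeta>" and "k2 = b * lam"
  define M where "M = (1 + \<zeta> * r * exp (\<omega> * r)) * 12 * (1 + c / \<zeta> * exp (\<zeta> * r) + lam) / (1 - \<kappa>)"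
  define P where "P = (1 + \<zeta> * r * exp (\<omega> * r)) * 24 * lam * exp \<omega> / (1 - \<kappa>)"
  have k: "0 < k1" "0 < k2"
  proof -
    have "1 * \<zeta> \<le> lam * \<zeta>" using tuned zeta_pos by (intro mult_right_mono) auto
    then show "0 < k1" using tuned by (simp add: k1_def)
    show "0 < k2" using tuned by (simp add: k2_def)
  qed
  have MP: "0 < M" "0 < P"
    using tuned zeta_pos r_pos c_pos by (auto simp: M_def P_def intro!: divide_pos_pos mult_pos_pos add_pos_pos)
  show ?thesis
  proof (rule exI[of _ k1], rule exI[of _ k2], rule exI[of _ \<delta>], rule exI[of _ P], rule exI[of _ M],
      rule exI[of _ \<omega>], intro conjI allI impI)
    fix \<tau> :: "nat \<Rightarrow> real" and v0 u \<xi> :: "real \<Rightarrow> real" and x0 :: real and z0 :: "real \<Rightarrow> real^2"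
    assume \<tau>: "sampling_sequence \<delta> \<tau>" and v0: "C1_on {0..1} v0" "c * deriv01 v0 0 = \<zeta> * x0" "v0 0 = 0"
      and z0: "continuous_on {-r..0} z0" and u: "continuous_on {0..} u" and \<xi>: "Linf_loc \<xi>"
    interpret reactor c r \<zeta> \<mu> K \<theta> u by unfold_locales (use assms K u in auto)
    obtain x where x: "with_history r (past_input v0) x"
      and ode: "\<And>t. 0 \<le> t \<Longrightarrow> (x has_real_derivative reactor_rhs x t) (at t within {0..})"
      and sol: "reactor_solution c \<mu> \<zeta> \<theta> u x0 v0 x (memory x)"
      and unique: "\<And>x' v' t. reactor_solution c \<mu> \<zeta> \<theta> u x0 v0 x' v' \<Longrightarrow> 0 \<le> t \<Longrightarrow>
        x' t = x t \<and> (\<forall>y\<in>{0..1}. v' t y = memory x t y)"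
      by (rule reactor_well_posed[OF v0(1,3,2)]) (rule that)
    interpret sampled_observer c r \<zeta> \<mu> K \<theta> u \<delta> \<tau> k1 k2 \<xi> "\<lambda>t. memory x t 1"
      by unfold_locales (use \<tau> k in auto)
    obtain z w where zw: "observer_solution r \<mu> \<zeta> \<theta> k1 k2 \<tau> u \<xi> (\<lambda>t. memory x t 1) z0 z w"
      by (rule observer_exists[OF z0]) (rule that)
    interpret observer_error c r \<zeta> \<mu> K \<theta> u \<delta> \<tau> k1 k2 \<xi> "\<lambda>t. memory x t 1" lam b \<omega> \<kappa> x z0 z w
      by unfold_locales (use tuned x ode zw in \<open>simp_all add: k1_def k2_def with_history_def\<close>)
    have closed: "closed_loop_solution c r \<mu> \<zeta> \<theta> k1 k2 \<tau> u \<xi> x0 v0 z0 x (memory x) z w"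
      using sol zw by (simp add: closed_loop_solution_def)
    have closed_unique: "(\<forall>t\<ge>0. x' t = x t \<and> (\<forall>y\<in>{0..1}. v' t y = memory x t y) \<and> w' t = w t) \<and> (\<forall>t\<ge>-r. z' t = z t)"
      if cl: "closed_loop_solution c r \<mu> \<zeta> \<theta> k1 k2 \<tau> u \<xi> x0 v0 z0 x' v' z' w'" for x' v' z' w'
    proof -
      have xv: "reactor_solution c \<mu> \<zeta> \<theta> u x0 v0 x' v'"
        and zw': "observer_solution r \<mu> \<zeta> \<theta> k1 k2 \<tau> u \<xi> (\<lambda>t. v' t 1) z0 z' w'"
        using cl by (simp_all add: closed_loop_solution_def)
      have "v' (\<tau> i) 1 = memory x (\<tau> i) 1" for i
        using unique[OF xv tau_nonneg] by simp
      then have "observer_solution r \<mu> \<zeta> \<theta> k1 k2 \<tau> u \<xi> (\<lambda>t. memory x t 1) z0 z' w'"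
        using zw' unfolding observer_solution_def by simp
      from observer_unique[OF z0 this zw] unique[OF xv] show ?thesis by blast
    qed
    have bound: "\<bar>x t - z t $ 2\<bar> + sup_norm01 (\<lambda>y. memory x t y - profile_estimate r \<zeta> z t y)
        \<le> exp (- \<omega> * t) * M * (sup_norm01 v0 + sup_norm01 (deriv01 v0) + \<bar>x0\<bar> + history_norm r z0)
          + P * (SUP s\<in>{0..t}. \<bar>\<xi> s\<bar> * exp (- \<omega> * (t - s)))" if t: "0 \<le> t" for t
      unfolding M_def P_def by (rule estimation_error_bound[OF v0(1,3) x z0 \<xi> refl t])
    have all_unique: "\<forall>x' v' z' w'. closed_loop_solution c r \<mu> \<zeta> \<theta> k1 k2 \<tau> u \<xi> x0 v0 z0 x' v' z' w' \<longrightarrow>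
        (\<forall>t\<ge>0. x' t = x t \<and> (\<forall>y\<in>{0..1}. v' t y = memory x t y) \<and> w' t = w t) \<and> (\<forall>t\<ge>-r. z' t = z t)"
      by (intro allI impI) (rule closed_unique)
    have all_bound: "\<forall>t\<ge>0. \<bar>x t - z t $ 2\<bar> + sup_norm01 (\<lambda>y. memory x t y - profile_estimate r \<zeta> z t y)
        \<le> exp (- \<omega> * t) * M * (sup_norm01 v0 + sup_norm01 (deriv01 v0) + \<bar>x0\<bar> + history_norm r z0)
          + P * (SUP s\<in>{0..t}. \<bar>\<xi> s\<bar> * exp (- \<omega> * (t - s)))"
      by (intro allI impI) (rule bound)
    show "\<exists>x v z w.
          closed_loop_solution c r \<mu> \<zeta> \<theta> k1 k2 \<tau> u \<xi> x0 v0 z0 x v z w \<and>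
          (\<forall>x' v' z' w'. closed_loop_solution c r \<mu> \<zeta> \<theta> k1 k2 \<tau> u \<xi> x0 v0 z0 x' v' z' w' \<longrightarrow>
             (\<forall>t\<ge>0. x' t = x t \<and> (\<forall>y\<in>{0..1}. v' t y = v t y) \<and> w' t = w t) \<and>
             (\<forall>t\<ge>-r. z' t = z t)) \<and>
          (\<forall>t\<ge>0.
             \<bar>x t - z t $ 2\<bar> + sup_norm01 (\<lambda>y. v t y - profile_estimate r \<zeta> z t y)
             \<le> exp (- \<omega> * t) * M *
                 (sup_norm01 v0 + sup_norm01 (deriv01 v0) + \<bar>x0\<bar> + history_norm r z0)
               + P * (SUP s\<in>{0..t}. \<bar>\<xi> s\<bar> * exp (- \<omega> * (t - s))))"
      by (rule exI[of _ x], rule exI[of _ "memory x"], rule exI[of _ z], rule exI[of _ w],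
          rule conjI[OF closed conjI[OF all_unique all_bound]])
  qed (use k MP tuned in auto)
qed

end
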